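(* Let $A$ and $B$ be Banach algebras, and suppose that: (a) $A$ is zero product determined; (b) $A$ has a bounded approximate identity; (c) $A$ is weakly amenable; (d) $B$ has a bounded approximate identity. Let $\Phi\colon A\to B$ be a surjective continuous linear map which preserves two-sided zero products. Then $\Phi$ is a weighted Jordan homomorphism.
   Context: Banach algebras are complex and associative, not assumed unital. Bounded approximate identities are two-sided. The notation $a\circ b$ stands for the Jordan product $ab+ba$. A Banach algebra $A$ is zero product determined if every continuous bilinear functional $\varphi\colon A\times A\to\mathbb{C}$ satisfying $\varphi(a,b)=0$ whenever $ab=0$ is of the form $\varphi(a,b)=\tau(ab)$ for some continuous linear functional $\tau$ on $A$. The dual $A^*$ is a Banach $A$-bimodule via $\langle b,a\cdot\omega\rangle=\langle ba,\omega\rangle$ and $\langle b,\omega\cdot a\rangle=\langle ab,\omega\rangle$ for $a,b\in A$, $\omega\in A^*$. The Banach algebra $A$ is weakly amenable if every continuous derivation $D\colon A\to A^*$ is inner, i.e. there is $\omega\in A^*$ with $D(a)=a\cdot\omega-\omega\cdot a$ for all $a\in A$. A linear map $\Phi\colon A\to B$ preserves two-sided zero products if for all $a,b\in A$, $ab=ba=0$ implies $\Phi(a)\Phi(b)=\Phi(b)\Phi(a)=0$. A Jordan homomorphism is a linear map $\Psi\colon A\to B$ with $\Psi(a\circ b)=\Psi(a)\circ\Psi(b)$ for all $a,b\in A$. A centralizer of $B$ is a linear map $W\colon B\to B$ with $W(ab)=W(a)b=aW(b)$ for all $a,b\in B$. A linear map $\Phi\colon A\to B$ is a weighted Jordan homomorphism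 if there exist an invertible centralizer $W$ of $B$ and a Jordan homomorphism $\Psi$ from $A$ to $B$ such that $\Phi=W\Psi$. *)

theory Defs
  imports "HOL-Analysis.Analysis"
begin

section \<open>Complex Banach algebras\<close>

text \<open>HOL-Analysis only has real normed algebras, so the complex structure is added on top of the
  real one. No unit is assumed, and the zero algebra is allowed.\<close>

class complex_normed_vector = real_normed_vector +
  fixes scaleC :: "complex \<Rightarrow> 'a \<Rightarrow> 'a" (infixr \<open>*\<^sub>C\<close> 75)
  assumes scaleC_add_right: "c *\<^sub>C (x + y) = c *\<^sub>C x + c *\<^sub>C y"
    and scaleC_add_left: "(c + d) *\<^sub>C x = c *\<^sub>C x + d *\<^sub>C x"
    and scaleC_scaleC: "c *\<^sub>C d *\<^sub>C x = (c * d) *\<^sub>C x"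
    and scaleC_of_real: "complex_of_real r *\<^sub>C x = r *\<^sub>R x"
    and norm_scaleC: "norm (c *\<^sub>C x) = cmod c * norm x"

class complex_banach_algebra = complex_normed_vector + real_normed_algebra + banach +
  assumes mult_scaleC_left: "(c *\<^sub>C x) * y = c *\<^sub>C (x * y)"
    and mult_scaleC_right: "x * (c *\<^sub>C y) = c *\<^sub>C (x * y)"

lemma scaleC_one: "1 *\<^sub>C x = (x :: 'a::complex_normed_vector)"
  using scaleC_of_real[of 1 x] by simp

lemma vector_space_scaleC:
  "vector_space (scaleC :: complex \<Rightarrow> 'a \<Rightarrow> 'a::complex_normed_vector)"
  by unfold_locales (simp_all add: scaleC_add_right scaleC_add_left scaleC_scaleC scaleC_one)

abbreviation clinear :: "('a::complex_normed_vector \<Rightarrow> 'b::complex_normed_vector) \<Rightarrow> bool"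
  where "clinear \<equiv> Vector_Spaces.linear scaleC scaleC"

lemma clinear_iff:
  "clinear f \<longleftrightarrow> (\<forall>x y. f (x + y) = f x + f y) \<and> (\<forall>c x. f (c *\<^sub>C x) = c *\<^sub>C f x)"
  by (simp add: Vector_Spaces.linear_iff vector_space_scaleC)

lemma bounded_linear_scaleC:
  "bounded_linear (scaleC c :: 'a::complex_normed_vector \<Rightarrow> 'a)"
proof (rule bounded_linear_intro[where K = "cmod c"])
  fix r :: real and x :: 'a
  have "c *\<^sub>C r *\<^sub>R x = (c * complex_of_real r) *\<^sub>C x"
    by (simp add: scaleC_scaleC flip: scaleC_of_real)
  also have "\<dots> = r *\<^sub>R c *\<^sub>C x"
    by (simp add: scaleC_scaleC mult.commute flip: scaleC_of_real)
  finally show "c *\<^sub>C r *\<^sub>R x = r *\<^sub>R c *\<^sub>C x" .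
qed (simp_all add: scaleC_add_right norm_scaleC mult.commute)

instantiation complex :: complex_banach_algebra
begin

definition scaleC_complex :: "complex \<Rightarrow> complex \<Rightarrow> complex"
  where "scaleC_complex c z = c * z"

instance
  by standard
    (simp_all add: scaleC_complex_def algebra_simps norm_mult scaleR_conv_of_real)

end

instantiation blinfun :: (real_normed_vector, complex_normed_vector) complex_normed_vector
begin

lift_definition scaleC_blinfun :: "complex \<Rightarrow> 'a \<Rightarrow>\<^sub>L 'b \<Rightarrow> 'a \<Rightarrow>\<^sub>L 'b"
  is "\<lambda>c f x. c *\<^sub>C f x"
  by (rule bounded_linear_compose[OF bounded_linear_scaleC])

instance
proof
  fix c d :: complex and f g :: "'a \<Rightarrow>\<^sub>L 'b" and r :: real
  show "c *\<^sub>C (f + g) = c *\<^sub>C f + c *\<^sub>C g"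
    by transfer (simp add: scaleC_add_right)
  show "(c + d) *\<^sub>C f = c *\<^sub>C f + d *\<^sub>C f"
    by transfer (simp add: scaleC_add_left)
  show "c *\<^sub>C d *\<^sub>C f = (c * d) *\<^sub>C f"
    by transfer (simp add: scaleC_scaleC)
  show "complex_of_real r *\<^sub>C f = r *\<^sub>R f"
    by transfer (simp add: scaleC_of_real)
  have le: "norm (e *\<^sub>C h) \<le> cmod e * norm h" for e and h :: "'a \<Rightarrow>\<^sub>L 'b"
  proof (rule norm_blinfun_bound)
    show "norm (blinfun_apply (e *\<^sub>C h) x) \<le> cmod e * norm h * norm x" for x
      using mult_left_mono[OF norm_blinfun[of h x], of "cmod e"]
      by (simp add: scaleC_blinfun.rep_eq norm_scaleC mult.assoc)
  qed simp
  show "norm (c *\<^sub>C f) = cmod c * norm f"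
  proof (cases "c = 0")
    case True
    then show ?thesis using le[of 0 f] by simp
  next
    case False
    have "inverse c *\<^sub>C c *\<^sub>C f = f"
      using False \<open>complex_of_real r *\<^sub>C f = r *\<^sub>R f\<close>
      by transfer (simp add: scaleC_scaleC scaleC_one)
    then have "norm f \<le> inverse (cmod c) * norm (c *\<^sub>C f)"
      using le[of "inverse c" "c *\<^sub>C f"] by (simp add: norm_inverse)
    then show ?thesis
      using False le[of c f] by (simp add: field_simps)
  qed
qed

end

section \<open>The dual bimodule and weak amenability\<close>

text \<open>The dual space is the set of complex-linear elements of the space of bounded real-linear
  maps into the complex numbers; its norm is the operator norm inherited from that space.\<close>

definition cdual :: "('a::complex_normed_vector \<Rightarrow>\<^sub>L complex) set"
  where "cdual = {\<omega>. clinear (blinfun_apply \<omega>)}"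

definition dual_left_act ::
    "'a::complex_banach_algebra \<Rightarrow> ('a \<Rightarrow>\<^sub>L complex) \<Rightarrow> ('a \<Rightarrow>\<^sub>L complex)"
  where "dual_left_act a \<omega> = \<omega> o\<^sub>L blinfun_mult_left a"

definition dual_right_act ::
    "('a::complex_banach_algebra \<Rightarrow>\<^sub>L complex) \<Rightarrow> 'a \<Rightarrow> ('a \<Rightarrow>\<^sub>L complex)"
  where "dual_right_act \<omega> a = \<omega> o\<^sub>L blinfun_mult_right a"

lemma dual_left_act_apply: "blinfun_apply (dual_left_act a \<omega>) b = blinfun_apply \<omega> (b * a)"
  by (simp add: dual_left_act_def)

lemma dual_right_act_apply: "blinfun_apply (dual_right_act \<omega> a) b = blinfun_apply \<omega> (a * b)"
  by (simp add: dual_right_act_def)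

lemma dual_act_in_cdual:
  assumes "\<omega> \<in> cdual"
  shows "dual_left_act a \<omega> \<in> cdual" "dual_right_act \<omega> a \<in> cdual"
  using assms
  by (simp_all add: cdual_def clinear_iff dual_left_act_apply dual_right_act_apply
      distrib_left distrib_right mult_scaleC_left mult_scaleC_right)

definition dual_derivation :: "('a::complex_banach_algebra \<Rightarrow> 'a \<Rightarrow>\<^sub>L complex) \<Rightarrow> bool"
  where "dual_derivation D \<longleftrightarrow> range D \<subseteq> cdual \<and> clinear D \<and>
    (\<forall>a b. D (a * b) = dual_left_act a (D b) + dual_right_act (D a) b)"

definition weakly_amenable :: "'a::complex_banach_algebra itself \<Rightarrow> bool"
  where "weakly_amenable _ \<longleftrightarrow>
    (\<forall>D :: 'a \<Rightarrow> 'a \<Rightarrow>\<^sub>L complex. dual_derivation D \<and> continuous_on UNIV D \<longrightarrow>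
      (\<exists>\<omega>\<in>cdual. \<forall>a. D a = dual_left_act a \<omega> - dual_right_act \<omega> a))"

section \<open>Zero product determined algebras and approximate identities\<close>

definition zero_product_determined :: "'a::complex_banach_algebra itself \<Rightarrow> bool"
  where "zero_product_determined _ \<longleftrightarrow>
    (\<forall>\<phi> :: 'a \<Rightarrow> 'a \<Rightarrow> complex.
      (\<forall>a. clinear (\<phi> a)) \<and> (\<forall>b. clinear (\<lambda>a. \<phi> a b)) \<and>
      continuous_on UNIV (\<lambda>(a, b). \<phi> a b) \<and>
      (\<forall>a b. a * b = 0 \<longrightarrow> \<phi> a b = 0) \<longrightarrow>
      (\<exists>\<tau> :: 'a \<Rightarrow> complex. clinear \<tau> \<and> continuous_on UNIV \<tau> \<and>
        (\<forall>a b. \<phi> a b = \<tau> (a * b))))"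

text \<open>A bounded net is represented by its eventuality filter on the algebra. Conversely, a proper
  filter as below yields the net of all pairs \<open>(S, e)\<close> with \<open>e \<in> S\<close>, where \<open>S\<close> ranges over the
  filter sets contained in the ball of radius \<open>C\<close>.\<close>

definition has_bounded_approximate_identity :: "'a::complex_banach_algebra itself \<Rightarrow> bool"
  where "has_bounded_approximate_identity _ \<longleftrightarrow>
    (\<exists>F :: 'a filter. F \<noteq> bot \<and> (\<exists>C. \<forall>\<^sub>F e in F. norm e \<le> C) \<and>
      (\<forall>a. ((\<lambda>e. e * a) \<longlongrightarrow> a) F \<and> ((\<lambda>e. a * e) \<longlongrightarrow> a) F))"

section \<open>Weighted Jordan homomorphisms\<close>

definition preserves_two_sided_zero_products ::
    "('a::complex_banach_algebra \<Rightarrow> 'b::complex_banach_algebra) \<Rightarrow> bool"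
  where "preserves_two_sided_zero_products \<Phi> \<longleftrightarrow>
    (\<forall>a b. a * b = 0 \<and> b * a = 0 \<longrightarrow> \<Phi> a * \<Phi> b = 0 \<and> \<Phi> b * \<Phi> a = 0)"

definition jordan_prod :: "'a::complex_banach_algebra \<Rightarrow> 'a \<Rightarrow> 'a"
  where "jordan_prod a b = a * b + b * a"

definition jordan_homomorphism ::
    "('a::complex_banach_algebra \<Rightarrow> 'b::complex_banach_algebra) \<Rightarrow> bool"
  where "jordan_homomorphism \<Psi> \<longleftrightarrow> clinear \<Psi> \<and>
    (\<forall>a b. \<Psi> (jordan_prod a b) = jordan_prod (\<Psi> a) (\<Psi> b))"

definition centralizer :: "('b::complex_banach_algebra \<Rightarrow> 'b) \<Rightarrow> bool"
  where "centralizer W \<longleftrightarrow> clinear W \<and>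
    (\<forall>a b. W (a * b) = W a * b \<and> W (a * b) = a * W b)"

definition weighted_jordan_homomorphism ::
    "('a::complex_banach_algebra \<Rightarrow> 'b::complex_banach_algebra) \<Rightarrow> bool"
  where "weighted_jordan_homomorphism \<Phi> \<longleftrightarrow>
    (\<exists>W \<Psi>. centralizer W \<and> bij W \<and> jordan_homomorphism \<Psi> \<and> \<Phi> = W \<circ> \<Psi>)"

end

theory Submission
  imports Defs
begin

text \<open>Let \<open>\<phi>\<close> be a continuous bilinear functional vanishing at \<open>(a, b)\<close> whenever
  \<open>a * b = b * a = 0\<close>. Using zero product determinacy twice and the approximate identity \<open>e\<close> gives
  \<open>\<phi> (z, v c) + \<phi> (c, z v) = \<phi> (c z, v) + \<mu> (z v c)\<close> with \<open>\<mu> v = lim \<phi> (e, v)\<close>. Hence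
  \<open>a \<mapsto> \<phi> (a, -) - a \<cdot> \<mu>\<close> is a derivation into the dual, and weak amenability yields
  \<open>\<phi> (a, b) = \<sigma> (a b) + \<tau> (b a)\<close>.

  For \<open>\<phi> (a, b) = \<xi> (\<Phi> a \<Phi> b)\<close> with \<open>\<xi>\<close> in the dual of \<open>B\<close> this shows that \<open>\<Phi> a \<circ> \<Phi> b\<close> depends only on
  \<open>a \<circ> b\<close>, with norm control by the Hahn-Banach theorem. So \<open>S a = lim (\<Phi> a \<circ> \<Phi> e) / 2\<close> exists,
  \<open>\<Phi> a \<circ> \<Phi> b = S (a \<circ> b)\<close>, and \<open>S a\<close> is the weak limit of both \<open>\<Phi> a \<Phi> e\<close> and \<open>\<Phi> e \<Phi> a\<close>. Then
  \<open>W (\<Phi> a) = S a\<close> defines a centralizer with \<open>y \<circ> z = W t\<close> solvable for all \<open>y, z\<close>, by the open mapping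
  theorem with \<open>t\<close> bounded in terms of \<open>y, z\<close>; this makes \<open>W\<close> bounded below and bijective, and
  \<open>inv W \<Phi>\<close> is a Jordan homomorphism.\<close>

section \<open>Norming functionals\<close>

definition sublinear :: "('a::real_vector \<Rightarrow> real) \<Rightarrow> bool"
  where "sublinear p \<longleftrightarrow> (\<forall>x y. p (x + y) \<le> p x + p y) \<and> (\<forall>t x. 0 \<le> t \<longrightarrow> p (t *\<^sub>R x) = t * p x)"

lemma sublinear_add: "sublinear p \<Longrightarrow> p (x + y) \<le> p x + p y"
  and sublinear_scale: "sublinear p \<Longrightarrow> 0 \<le> t \<Longrightarrow> p (t *\<^sub>R x) = t * p x"
  by (auto simp: sublinear_def)

lemma sublinear_zero: "sublinear p \<Longrightarrow> p 0 = 0"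
  using sublinear_scale[of p 0 0] by simp

lemma sublinear_neg: "sublinear p \<Longrightarrow> - p (- x) \<le> p x"
  using sublinear_add[of p x "- x"] sublinear_zero[of p] by simp

text \<open>The tilt is the infimum over \<open>t \<ge> 0\<close> of
  \<open>p (x + t y) - t p y\<close>. Subadditivity bounds these numbers below by
  \<open>- p (- x)\<close>, so the infimum is finite; the parameters \<open>0\<close> and
  \<open>1\<close> give the two upper bounds.\<close>

lemma sublinear_tilt:
  assumes p: "sublinear p"
  obtains q where "sublinear q" "\<And>x. q x \<le> p x" "\<And>x. q x \<le> p (x + y) - p y"
proof
  define g where "g = (\<lambda>x t. p (x + t *\<^sub>R y) - t * p y)"
  define q where "q = (\<lambda>x. INF t\<in>{0..}. g x t)"
  have low: "- p (- x) \<le> g x t" if "0 \<le> t" for x t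
    using sublinear_add[OF p, of "x + t *\<^sub>R y" "- x"] sublinear_scale[OF p that, of y]
    by (simp add: g_def)
  have bdd: "bdd_below (g x ` {0..})" for x
    by (rule bdd_belowI2[of _ "- p (- x)"]) (simp add: low)
  have q_le: "q x \<le> g x t" if "0 \<le> t" for x t
    unfolding q_def using bdd that by (intro cINF_lower) auto
  show "q x \<le> p x" for x
    using q_le[of 0 x] by (simp add: g_def)
  show "q x \<le> p (x + y) - p y" for x
    using q_le[of 1 x] by (simp add: g_def)
  have q_ge: "c \<le> q x" if "\<And>t. 0 \<le> t \<Longrightarrow> c \<le> g x t" for x c
    unfolding q_def using that by (intro cINF_greatest) auto
  have add: "q (x + z) \<le> q x + q z" for x z
  proof -
    have "q (x + z) \<le> g x s + g z t" if "0 \<le> s" "0 \<le> t" for s t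
    proof -
      have "q (x + z) \<le> g (x + z) (s + t)"
        using that by (intro q_le) simp
      also have "\<dots> \<le> g x s + g z t"
        using sublinear_add[OF p, of "x + s *\<^sub>R y" "z + t *\<^sub>R y"]
        by (simp add: g_def algebra_simps)
      finally show ?thesis .
    qed
    \<comment> \<open>The infimum over \<open>s\<close> is taken first with \<open>t\<close> fixed,
      then the infimum over \<open>t\<close>.\<close>
    then have "q (x + z) - g z t \<le> q x" if "0 \<le> t" for t
      using that by (intro q_ge) (simp add: diff_le_eq)
    then have "q (x + z) - q x \<le> q z"
      by (intro q_ge) (simp add: diff_le_eq add.commute)
    then show ?thesis by simp
  qed
  have zero: "q 0 = 0"
    using q_le[of 0 0] q_ge[of 0 0] low[of _ 0] sublinear_zero[OF p] by (force simp: g_def)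
  have scale_le: "q (r *\<^sub>R x) \<le> r * q x" if "0 < r" for r x
  proof -
    have "q (r *\<^sub>R x) / r \<le> q x"
    proof (rule q_ge)
      fix t :: real assume "0 \<le> t"
      have "q (r *\<^sub>R x) \<le> g (r *\<^sub>R x) (r * t)"
        using that \<open>0 \<le> t\<close> by (intro q_le) simp
      also have "\<dots> = r * g x t"
        using sublinear_scale[OF p, of r "x + t *\<^sub>R y"] that by (simp add: g_def algebra_simps)
      finally show "q (r *\<^sub>R x) / r \<le> g x t"
        using that by (simp add: field_simps)
    qed
    then show ?thesis using that by (simp add: field_simps)
  qed
  have "q (r *\<^sub>R x) = r * q x" if "0 \<le> r" for r x
  proof (cases "r = 0")
    case False
    then have "0 < r" using that by simp
    \<comment> \<open>The reverse inequality is the same bound for the factor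
      \<open>inverse r\<close> at the point \<open>r x\<close>.\<close>
    then have "r * q (inverse r *\<^sub>R r *\<^sub>R x) \<le> r * (inverse r * q (r *\<^sub>R x))"
      by (intro mult_left_mono scale_le) auto
    then have "r * q x \<le> q (r *\<^sub>R x)" using \<open>0 < r\<close> by (simp add: field_simps)
    then show ?thesis using scale_le[of r x] \<open>0 < r\<close> by simp
  qed (simp add: zero)
  with add show "sublinear q" by (simp add: sublinear_def)
qed

text \<open>A minimal sublinear functional is linear, since tilting it in any direction does not change it.\<close>
lemma linear_below_sublinear:
  fixes p :: "'a::real_vector \<Rightarrow> real"
  assumes p: "sublinear p"
  obtains f where "linear f" "\<And>x. f x \<le> p x"
proof -
  define A where "A = {q. sublinear q \<and> q \<le> p}"
  \<comment> \<open>Zorn's lemma is used for the reversed pointwise order, so a chain needs a lower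
    bound in \<open>A\<close>; its pointwise infimum serves.\<close>
  have "\<exists>m\<in>A. \<forall>q\<in>A. q \<le> m \<longrightarrow> q = m"
  proof (rule predicate_Zorn)
    show "partial_order_on A (relation_of (\<lambda>m q. q \<le> m) A)"
      by (rule partial_order_on_relation_ofI) auto
    fix C assume C: "C \<in> Chains (relation_of (\<lambda>m q. q \<le> m) A)"
    have CA: "C \<subseteq> A" and total: "\<And>q r. q \<in> C \<Longrightarrow> r \<in> C \<Longrightarrow> q \<le> r \<or> r \<le> q"
      using C unfolding Chains_def relation_of_def by blast+
    show "\<exists>u\<in>A. \<forall>a\<in>C. u \<le> a"
    proof (cases "C = {}")
      case True
      then show ?thesis using p by (auto simp: A_def)
    next
      case False
      define u where "u = (\<lambda>x. INF q\<in>C. q x)"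
      have sub: "sublinear q" and below: "q x \<le> p x" if "q \<in> C" for q x
        using that CA by (auto simp: A_def le_fun_def)
      have low: "- p (- x) \<le> q x" if "q \<in> C" for q x
        using sublinear_neg[OF sub[OF that], of x] below[OF that, of "- x"] by linarith
      have bdd: "bdd_below ((\<lambda>q. q x) ` C)" for x
        by (rule bdd_belowI2[of _ "- p (- x)"]) (simp add: low)
      have u_le: "u x \<le> q x" if "q \<in> C" for q x
        unfolding u_def using bdd that by (intro cINF_lower)
      have u_ge: "c \<le> u x" if "\<And>q. q \<in> C \<Longrightarrow> c \<le> q x" for c x
        unfolding u_def using that False by (intro cINF_greatest)
      have "u (x + y) \<le> u x + u y" for x y
      proof -
        have le: "u (x + y) \<le> q x + r y" if "q \<in> C" "r \<in> C" for q r
        proof -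
          \<comment> \<open>Totality of the chain yields one member below both \<open>q\<close> and
            \<open>r\<close>, and its own subadditivity then combines the two infima.\<close>
          have "\<exists>s\<in>C. s \<le> q \<and> s \<le> r" using total[OF that] that by auto
          then obtain s where s: "s \<in> C" "s x \<le> q x" "s y \<le> r y" by (auto simp: le_fun_def)
          have "u (x + y) \<le> s x + s y"
            using u_le[OF s(1), of "x + y"] sublinear_add[OF sub[OF s(1)], of x y] by linarith
          then show ?thesis using s by linarith
        qed
        then have "u (x + y) - r y \<le> u x" if "r \<in> C" for r
          using that by (intro u_ge) (simp add: diff_le_eq)
        then have "u (x + y) - u x \<le> u y"
          by (intro u_ge) (simp add: diff_le_eq add.commute)
        then show ?thesis by simp
      qed
      moreover have "u (t *\<^sub>R x) = t * u x" if "0 \<le> t" for t x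
      proof -
        have "u (t *\<^sub>R x) = (INF q\<in>C. t * q x)"
          unfolding u_def using sublinear_scale[OF sub that] by (intro INF_cong refl)
        also have "\<dots> = t * u x"
        proof (cases "t = 0")
          case False
          then have "0 < t" using that by simp
          then have "mono ((*) t)" by (simp add: mono_def)
          moreover have "continuous (at_right (Inf ((\<lambda>q. q x) ` C))) ((*) t)"
            by (intro continuous_intros)
          ultimately have "t * Inf ((\<lambda>q. q x) ` C) = Inf ((*) t ` (\<lambda>q. q x) ` C)"
            using bdd \<open>C \<noteq> {}\<close> by (intro continuous_at_Inf_mono) auto
          then show ?thesis by (simp add: u_def image_image)
        qed (use \<open>C \<noteq> {}\<close> in simp)
        finally show ?thesis .
      qed
      ultimately have "sublinear u" by (simp add: sublinear_def)
      moreover obtain q where "q \<in> C" using False by blast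
      then have "u \<le> p" using u_le below by (meson le_funI order_trans)
      ultimately show ?thesis using u_le by (auto simp: A_def le_fun_def)
    qed
  qed
  then obtain m where m: "sublinear m" "m \<le> p"
    and minimal: "\<And>q. sublinear q \<Longrightarrow> q \<le> p \<Longrightarrow> q \<le> m \<Longrightarrow> q = m"
    by (auto simp: A_def)
  have m_add: "m (x + y) = m x + m y" for x y
  proof -
    obtain q where q: "sublinear q" "\<And>x. q x \<le> m x" "\<And>x. q x \<le> m (x + y) - m y"
      using sublinear_tilt[OF m(1)] by blast
    then have "q \<le> m" by (simp add: le_fun_def)
    then have "q = m" using minimal[OF q(1)] m(2) by force
    then show ?thesis using q(3)[of x] sublinear_add[OF m(1), of x y] by simp
  qed
  then have m_neg: "m (- x) = - m x" for x
    using m_add[of x "- x"] sublinear_zero[OF m(1)] by simp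
  have "m (t *\<^sub>R x) = t * m x" for t x
    using sublinear_scale[OF m(1), of t x] sublinear_scale[OF m(1), of "- t" x] m_neg[of "t *\<^sub>R x"]
    by (cases "0 \<le> t") auto
  with m_add have "linear m" by (intro linearI) auto
  then show thesis using that m(2) by (simp add: le_fun_def)
qed

text \<open>Tilting the norm in direction \<open>a\<close> before taking a linear minorant forces
  \<open>f (- a) \<le> - norm a\<close>, which is the missing half of
  \<open>f a = norm a\<close>.\<close>

lemma real_norming_functional:
  fixes a :: "'a::real_normed_vector"
  obtains f :: "'a \<Rightarrow> real" where "linear f" "f a = norm a" "\<And>x. \<bar>f x\<bar> \<le> norm x"
proof -
  have "sublinear (norm :: 'a \<Rightarrow> real)" by (simp add: sublinear_def norm_triangle_ineq)
  then obtain q :: "'a \<Rightarrow> real" where q: "sublinear q" "\<And>x. q x \<le> norm x" "\<And>x. q x \<le> norm (x + a) - norm a"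
    using sublinear_tilt by blast
  obtain f where f: "linear f" "\<And>x. f x \<le> q x" using linear_below_sublinear[OF q(1)] by blast
  have le: "f x \<le> norm x" for x using f(2) q(2) order_trans by blast
  have abs: "\<bar>f x\<bar> \<le> norm x" for x using le[of x] le[of "- x"] linear_neg[OF f(1), of x] by simp
  have "f (- a) \<le> - norm a" using f(2)[of "- a"] q(3)[of "- a"] by simp
  then have "f a = norm a" using le[of a] linear_neg[OF f(1), of a] by simp
  with f(1) abs that show thesis by blast
qed

section \<open>Passage from real to complex norming functionals\<close>

lemma scaleC_scaleR_commute: "c *\<^sub>C r *\<^sub>R x = r *\<^sub>R c *\<^sub>C (x :: 'a::complex_normed_vector)"
  by (simp add: scaleC_scaleC mult.commute flip: scaleC_of_real)

lemma clinear_add: "clinear f \<Longrightarrow> f (x + y) = f x + f y"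
  and clinear_scaleC: "clinear f \<Longrightarrow> f (c *\<^sub>C x) = c *\<^sub>C f x"
  by (simp_all add: clinear_iff)

lemma clinear_imp_linear: "clinear f \<Longrightarrow> linear f"
  by (intro linearI) (simp_all add: clinear_add clinear_scaleC flip: scaleC_of_real)

text \<open>Multiplying \<open>x\<close> by a unimodular \<open>c\<close> makes
  \<open>f (c x)\<close> real and equal to the modulus of \<open>f x\<close>, so a bound on real
  parts is enough.\<close>

lemma clinear_norm_le_one:
  fixes f :: "'a::complex_normed_vector \<Rightarrow> complex"
  assumes f: "clinear f" and "\<And>x. Re (f x) \<le> norm x"
  shows "cmod (f x) \<le> norm x"
proof -
  obtain c where c: "cmod c = 1" "c * f x = complex_of_real (cmod (f x))"
  proof (cases "f x = 0")
    case False
    have "cnj (f x) * f x = complex_of_real ((cmod (f x))\<^sup>2)"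
      using complex_norm_square[of "f x"] by (simp add: mult.commute)
    then show thesis
      using False
      by (intro that[of "cnj (f x) / complex_of_real (cmod (f x))"])
        (simp_all add: norm_divide power2_eq_square)
  qed (rule that[of 1], auto)
  have "cmod (f x) = Re (f (c *\<^sub>C x))"
    using c(2) clinear_scaleC[OF f, of c x] by (simp add: scaleC_complex_def)
  also have "\<dots> \<le> norm x" using assms(2)[of "c *\<^sub>C x"] c(1) by (simp add: norm_scaleC)
  finally show ?thesis .
qed

text \<open>The complex functional is recovered from its real part \<open>u\<close> as
  \<open>u x - i u (i x)\<close>.\<close>

lemma norming_functional:
  fixes a :: "'a::complex_normed_vector"
  obtains f :: "'a \<Rightarrow> complex"
  where "clinear f" "f a = complex_of_real (norm a)" "\<And>x. cmod (f x) \<le> norm x"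
proof -
  obtain u :: "'a \<Rightarrow> real" where u: "linear u" "u a = norm a" "\<And>x. \<bar>u x\<bar> \<le> norm x"
    using real_norming_functional[of a] by blast
  define f where "f x = Complex (u x) (- u (\<i> *\<^sub>C x))" for x
  have uC: "u (c *\<^sub>C x) = Re c * u x + Im c * u (\<i> *\<^sub>C x)" for c x
  proof -
    have "c *\<^sub>C x = Re c *\<^sub>R x + Im c *\<^sub>R (\<i> *\<^sub>C x)"
      by (simp add: scaleC_scaleC mult.commute complex_eq[symmetric] 
        flip: scaleC_of_real scaleC_add_left)
    then show ?thesis by (simp add: linear_add[OF u(1)] linear_scale[OF u(1)])
  qed
  have "f (x + y) = f x + f y" for x y
    by (simp add: f_def linear_add[OF u(1)] scaleC_add_right complex_eq_iff)
  moreover have "f (c *\<^sub>C x) = c *\<^sub>C f x" for c x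
    using uC[of c x] uC[of "\<i> * c" x]
    by (simp add: f_def complex_eq_iff scaleC_complex_def scaleC_scaleC algebra_simps)
  ultimately have f: "clinear f" by (simp add: clinear_iff)
  have bound: "cmod (f x) \<le> norm x" for x
    by (rule clinear_norm_le_one[OF f]) (use u(3) abs_le_iff in \<open>auto simp: f_def\<close>)
  moreover have "f a = complex_of_real (norm a)"
  proof -
    \<comment> \<open>The real part of \<open>f a\<close> is already \<open>norm a\<close>, so the
      bound on the modulus leaves no room for an imaginary part.\<close>
    have "(norm a)\<^sup>2 + (Im (f a))\<^sup>2 \<le> (norm a)\<^sup>2"
      using power_mono[OF bound[of a], of 2] by (simp add: cmod_power2) (simp add: f_def u(2))
    then show ?thesis by (simp add: f_def complex_eq_iff u(2))
  qed
  ultimately show thesis using f that by blast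
qed

section \<open>Bounded preimages and limits along filters\<close>

lemma bounded_linear_approx_preimages:
  fixes f :: "'a::banach \<Rightarrow> 'b::banach"
  assumes f: "bounded_linear f" and "surj f"
  obtains M where "0 \<le> M" "\<And>y. \<exists>x. norm x \<le> M * norm y \<and> norm (y - f x) \<le> norm y / 2"
proof -
  interpret f: bounded_linear f by fact
  define T where "T n = closure (f ` ball 0 (real n))" for n
  have "\<exists>n. y \<in> T n" for y
  proof -
    obtain x where x: "y = f x" using \<open>surj f\<close> by blast
    moreover obtain n where "norm x < real n" using reals_Archimedean2 by blast
    ultimately have "y \<in> T n" using closure_subset by (force simp: T_def)
    then show ?thesis ..
  qed
  \<comment> \<open>By Baire's theorem one of the closed sets \<open>T n\<close> has interior. The
    ball found in it is centred at some \<open>y0\<close>, not yet at \<open>0\<close>.\<close>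
  then have "\<Union>(range T) = UNIV" by blast
  then have "interior (\<Union>(range T)) \<noteq> {}" by simp
  moreover have "interior (\<Union>(range T)) = {}" if "\<And>n. interior (T n) = {}"
  proof -
    have "closed S \<and> interior S = {}" if "S \<in> range T" for S
      using that \<open>\<And>n. interior (T n) = {}\<close> by (auto simp: T_def)
    then show ?thesis
      using Met_TC.metric_Baire_category_alt[where 'a='b, of "range T"] by (simp add: complete_UNIV)
  qed
  ultimately obtain n where "interior (T n) \<noteq> {}" by blast
  then obtain y0 r where r: "0 < r" "cball y0 r \<subseteq> T n"
    by (metis all_not_in_conv mem_interior_cball)
  \<comment> \<open>Half the difference of approximate preimages of \<open>y0 + y\<close> and
    \<open>y0 - y\<close> cancels the centre \<open>y0\<close>.\<close>
  have approx: "\<exists>x. norm x \<le> real n \<and> norm (y - f x) < e" if y: "norm y \<le> r" and "0 < e" for y e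
  proof -
    have "\<exists>u. norm u < n \<and> dist (f u) w < e" if "w \<in> T n" for w
      using that \<open>0 < e\<close> by (force simp: T_def closure_approachable)
    moreover have "y0 + y \<in> T n" "y0 - y \<in> T n" using y r by (auto simp: dist_norm)
    ultimately obtain u v where uv: "norm u < n" "dist (f u) (y0 + y) < e" "norm v < n" "dist (f v) (y0 - y) < e"
      by blast
    define x where "x = (1/2) *\<^sub>R (u - v)"
    have "norm x \<le> real n"
      using norm_triangle_ineq4[of u v] uv by (simp add: x_def)
    moreover have "y - f x = (1/2) *\<^sub>R ((y0 + y - f u) - (y0 - y - f v))"
    proof -
      have "y = (1/2) *\<^sub>R (y + y)" by (metis scaleR_half_double)
      then show ?thesis by (simp add: x_def f.scaleR f.diff algebra_simps)
    qed
    then have "norm (y - f x) \<le> (1/2) * (norm (y0 + y - f u) + norm (y0 - y - f v))"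
      using norm_triangle_ineq4[of "y0 + y - f u" "y0 - y - f v"] by simp
    then have "norm (y - f x) < e"
      using uv by (simp add: dist_norm norm_minus_commute)
    ultimately show ?thesis by blast
  qed
  show thesis
  proof
    show "0 \<le> real n / r" using r by simp
    fix y
    show "\<exists>x. norm x \<le> real n / r * norm y \<and> norm (y - f x) \<le> norm y / 2"
    proof (cases "y = 0")
      case False
      \<comment> \<open>Dividing by \<open>t\<close> puts \<open>y\<close> on the sphere of radius
        \<open>r\<close>; scaling back turns the error \<open>r / 2\<close> into
        \<open>norm y / 2\<close>.\<close>
      define t where "t = norm y / r"
      have t: "0 < t" using False r by (simp add: t_def)
      have "norm ((1/t) *\<^sub>R y) \<le> r" using False r by (simp add: t_def)
      then obtain x where x: "norm x \<le> real n" "norm ((1/t) *\<^sub>R y - f x) < r / 2"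
        using approx[of "(1/t) *\<^sub>R y" "r / 2"] r by auto
      have "y - f (t *\<^sub>R x) = t *\<^sub>R ((1/t) *\<^sub>R y - f x)"
        using t by (simp add: f.scaleR scaleR_diff_right)
      then have "norm (y - f (t *\<^sub>R x)) = t * norm ((1/t) *\<^sub>R y - f x)"
        using t by simp
      also have "\<dots> \<le> t * (r / 2)" using x t by (intro mult_left_mono) auto
      also have "\<dots> = norm y / 2" using r by (simp add: t_def)
      finally have "norm (y - f (t *\<^sub>R x)) \<le> norm y / 2" .
      moreover have "norm (t *\<^sub>R x) \<le> real n / r * norm y"
        using mult_left_mono[OF x(1), of t] t r by (simp add: t_def mult.commute)
      ultimately show ?thesis by blast
    qed (auto intro: exI[of _ 0] simp: f.zero)
  qed
qed

text \<open>The approximate preimage is corrected repeatedly. Each correction halves the residual,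
  so the corrections are dominated by a geometric series with sum at most
  \<open>2 * M * norm y\<close>.\<close>

lemma bounded_linear_surj_bounded_preimages:
  fixes f :: "'a::banach \<Rightarrow> 'b::banach"
  assumes f: "bounded_linear f" and "surj f"
  obtains K where "0 \<le> K" "\<And>y. \<exists>x. f x = y \<and> norm x \<le> K * norm y"
proof -
  interpret f: bounded_linear f by fact
  obtain M where M: "0 \<le> M" "\<And>y. \<exists>x. norm x \<le> M * norm y \<and> norm (y - f x) \<le> norm y / 2"
    using bounded_linear_approx_preimages[OF assms] by blast
  then obtain g where g: "\<And>y. norm (g y) \<le> M * norm y" "\<And>y. norm (y - f (g y)) \<le> norm y / 2"
    by metis
  have "\<exists>x. f x = y \<and> norm x \<le> 2 * M * norm y" for y
  proof -
    \<comment> \<open>\<open>Y k\<close> is the residual after \<open>k\<close> corrections; the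
      images of the corrections telescope to \<open>y\<close>.\<close>
    define Y where "Y k = ((\<lambda>y. y - f (g y)) ^^ k) y" for k
    have Y_Suc: "Y (Suc k) = Y k - f (g (Y k))" for k by (simp add: Y_def)
    have Y_le: "norm (Y k) \<le> (1/2) ^ k * norm y" for k
    proof (induction k)
      case (Suc k)
      then show ?case using g(2)[of "Y k"] by (simp add: Y_Suc)
    qed (simp add: Y_def)
    have gY_le: "norm (g (Y k)) \<le> M * norm y * (1/2) ^ k" for k
      using g(1)[of "Y k"] mult_left_mono[OF Y_le[of k] M(1)] by (simp add: mult_ac)
    have geo: "(\<lambda>k. M * norm y * (1/2) ^ k) sums (M * norm y * 2)"
      using geometric_sums[of "1/2 :: real"] by (intro sums_mult) simp
    have summ: "summable (\<lambda>k. norm (g (Y k)))"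
      by (rule summable_comparison_test'[OF sums_summable[OF geo], of 0]) (simp add: gY_le)
    have "norm (\<Sum>k. g (Y k)) \<le> (\<Sum>k. norm (g (Y k)))"
      by (rule summable_norm[OF summ])
    also have "\<dots> \<le> M * norm y * 2"
      using sums_le[OF gY_le summable_sums[OF summ] geo] .
    finally have bound: "norm (\<Sum>k. g (Y k)) \<le> 2 * M * norm y" by (simp add: mult_ac)
    have "(\<lambda>k. (1/2::real) ^ k * norm y) \<longlonglongrightarrow> 0"
      by (intro tendsto_mult_left_zero LIMSEQ_power_zero) simp
    then have "Y \<longlonglongrightarrow> 0"
      by (rule Lim_null_comparison[rotated]) (simp add: Y_le)
    then have "(\<lambda>k. Y k - Y (Suc k)) sums (Y 0 - 0)" by (rule telescope_sums')
    then have "(\<lambda>k. f (g (Y k))) sums y" by (simp add: Y_Suc) (simp add: Y_def)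
    moreover have "(\<lambda>k. f (g (Y k))) sums f (\<Sum>k. g (Y k))"
      by (intro f.sums summable_sums summable_norm_cancel[OF summ])
    ultimately show ?thesis using bound sums_unique2 by blast
  qed
  with M(1) that[of "2 * M"] show thesis by simp
qed

section \<open>Existence of limits along filters in complete spaces\<close>

lemma filter_limit_exists:
  fixes f :: "'a \<Rightarrow> 'b::banach"
  assumes "F \<noteq> bot"
    and "\<And>e. 0 < e \<Longrightarrow> \<exists>P. eventually P F \<and> (\<forall>x y. P x \<and> P y \<longrightarrow> dist (f x) (f y) < e)"
  shows "\<exists>l. (f \<longlongrightarrow> l) F"
proof -
  have "cauchy_filter (filtermap f F)"
    using assms(2) by (simp add: cauchy_filter_metric_filtermap)
  moreover have "filtermap f F \<noteq> bot" using assms(1) by (simp add: filtermap_bot_iff)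
  ultimately show ?thesis
    using complete_uniform[of "UNIV :: 'b set"] complete_UNIV by (force simp: filterlim_def)
qed

text \<open>Convergence of \<open>g\<close> transfers to \<open>f\<close> through the Cauchy
  criterion. This serves for the limit defining \<open>S\<close> and for the preimages under
  \<open>W\<close>.\<close>

lemma filter_limit_exists_dominated:
  fixes f :: "'a \<Rightarrow> 'b::banach" and g :: "'a \<Rightarrow> 'c::metric_space"
  assumes "F \<noteq> bot" and g: "(g \<longlongrightarrow> l) F" and "0 \<le> K"
    and le: "\<And>x y. dist (f x) (f y) \<le> K * dist (g x) (g y)"
  shows "\<exists>l. (f \<longlongrightarrow> l) F"
proof (rule filter_limit_exists[OF assms(1)])
  fix e :: real assume "0 < e"
  \<comment> \<open>Two points within \<open>d\<close> of \<open>l\<close> are at most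
    \<open>2 * d\<close> apart; \<open>K + 1\<close> avoids division by zero and makes the final
    inequality strict.\<close>
  define d where "d = e / (2 * (K + 1))"
  have "0 < d" using \<open>0 < e\<close> \<open>0 \<le> K\<close> by (simp add: d_def)
  have "dist (f x) (f y) < e" if "dist (g x) l < d" "dist (g y) l < d" for x y
  proof -
    have "dist (g x) (g y) \<le> 2 * d" using dist_triangle2[of "g x" "g y" l] that by simp
    then have "dist (f x) (f y) \<le> K * (2 * d)"
      using le[of x y] mult_left_mono[OF _ \<open>0 \<le> K\<close>] by (meson order_trans)
    also have "\<dots> < (K + 1) * (2 * d)" using \<open>0 < d\<close> by simp
    also have "\<dots> = e" using \<open>0 \<le> K\<close> by (simp add: d_def field_simps)
    finally show ?thesis .
  qed
  with tendstoD[OF g \<open>0 < d\<close>]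
  show "\<exists>P. eventually P F \<and> (\<forall>x y. P x \<and> P y \<longrightarrow> dist (f x) (f y) < e)" by blast
qed

text \<open>A uniform limit of convergent functions is Cauchy; the approximant may change with the
  tolerance.\<close>

lemma filter_limit_exists_approx:
  fixes f :: "'a \<Rightarrow> 'b::banach"
  assumes "F \<noteq> bot"
    and approx: "\<And>e. 0 < e \<Longrightarrow> \<exists>g l. (g \<longlongrightarrow> l) F \<and> (\<forall>\<^sub>F x in F. dist (f x) (g x) < e)"
  shows "\<exists>l. (f \<longlongrightarrow> l) F"
proof (rule filter_limit_exists[OF assms(1)])
  fix e :: real assume "0 < e"
  then obtain g l where g: "(g \<longlongrightarrow> l) F" "\<forall>\<^sub>F x in F. dist (f x) (g x) < e / 4"
    using approx[of "e / 4"] by auto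
  have "\<forall>\<^sub>F x in F. dist (g x) l < e / 4"
    using tendstoD[OF g(1), of "e / 4"] \<open>0 < e\<close> by simp
  then have "\<forall>\<^sub>F x in F. dist (f x) l < e / 2"
    using g(2)
  proof eventually_elim
    case (elim x)
    then show ?case using dist_triangle[of "f x" l "g x"] by simp
  qed
  then show "\<exists>P. eventually P F \<and> (\<forall>x y. P x \<and> P y \<longrightarrow> dist (f x) (f y) < e)"
    by (intro exI[of _ "\<lambda>x. dist (f x) l < e / 2"]) (auto intro: dist_triangle_half_l[of _ l])
qed

section \<open>Functionals vanishing on two-sided zero products\<close>

locale approximate_identity =
  fixes F :: "'a::complex_banach_algebra filter" and C :: real
  assumes nontrivial: "F \<noteq> bot"
    and norm_le: "\<forall>\<^sub>F e in F. norm e \<le> C"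
    and left: "((\<lambda>e. e * a) \<longlongrightarrow> a) F"
    and right: "((\<lambda>e. a * e) \<longlongrightarrow> a) F"

lemma bai_obtains:
  assumes "has_bounded_approximate_identity TYPE('a::complex_banach_algebra)"
  obtains F :: "'a::complex_banach_algebra filter" and C where "approximate_identity F C"
  using assms by (auto simp: has_bounded_approximate_identity_def approximate_identity_def)

lemma (in approximate_identity) C_nonneg: "0 \<le> C"
proof -
  obtain e :: 'a where "norm e \<le> C"
    using eventually_happens'[OF nontrivial norm_le] by blast
  then show ?thesis using norm_ge_zero order_trans by blast
qed

locale bounded_cbilinear = bounded_bilinear \<phi>
  for \<phi> :: "'a::complex_normed_vector \<Rightarrow> 'b::complex_normed_vector \<Rightarrow> complex" +
  assumes clinear_right: "clinear (\<phi> a)"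
    and clinear_left: "clinear (\<lambda>a. \<phi> a b)"

text \<open>The functional factors through the product, so associativity lets \<open>c\<close>
  change sides. Zero product determinacy enters the proof only in this form.\<close>

lemma zpd_balanced:
  fixes \<phi> :: "'a::complex_banach_algebra \<Rightarrow> 'a \<Rightarrow> complex"
  assumes "zero_product_determined TYPE('a)"
    and "bounded_cbilinear \<phi>"
    and zero: "\<And>a b. a * b = 0 \<Longrightarrow> \<phi> a b = 0"
  shows "\<phi> (a * c) b = \<phi> a (c * b)"
proof -
  interpret bounded_cbilinear \<phi> by fact
  have "continuous_on UNIV (\<lambda>(a, b). \<phi> a b)"
    using continuous_on[OF continuous_on_fst continuous_on_snd, OF continuous_on_id continuous_on_id, of UNIV]
    by (simp add: case_prod_beta')
  then obtain \<tau> where "\<And>a b. \<phi> a b = \<tau> (a * b)"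
    using assms(1)[unfolded zero_product_determined_def, rule_format, of \<phi>] zero clinear_right clinear_left by blast
  then show ?thesis by (simp add: mult.assoc)
qed

lemma (in bounded_cbilinear) comp_mult:
  fixes f :: "'c::complex_normed_vector \<Rightarrow> 'a" and g :: "'d::complex_normed_vector \<Rightarrow> 'b"
  assumes "bounded_linear f" "clinear f" "bounded_linear g" "clinear g"
  shows "bounded_cbilinear (\<lambda>x y. \<phi> (f x) (g y))"
proof (intro bounded_cbilinear.intro bounded_cbilinear_axioms.intro)
  show "bounded_bilinear (\<lambda>x y. \<phi> (f x) (g y))"
    by (rule comp) fact+
qed (use assms(2,4) clinear_right clinear_left in \<open>simp_all add: clinear_iff\<close>)

lemma bounded_cbilinear_diff:
  assumes "bounded_cbilinear \<phi>" "bounded_cbilinear \<psi>"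
  shows "bounded_cbilinear (\<lambda>x y. \<phi> x y - \<psi> x y)"
proof -
  interpret \<phi>: bounded_cbilinear \<phi> by fact
  interpret \<psi>: bounded_cbilinear \<psi> by fact
  obtain K L where "\<And>x y. norm (\<phi> x y) \<le> norm x * norm y * K" "\<And>x y. norm (\<psi> x y) \<le> norm x * norm y * L"
    using \<phi>.bounded \<psi>.bounded by blast
  note le = this
  have "norm (\<phi> x y - \<psi> x y) \<le> norm x * norm y * (K + L)" for x y
    using norm_triangle_ineq4[of "\<phi> x y" "\<psi> x y"] le(1)[of x y] le(2)[of x y]
    by (simp add: distrib_left)
  then have "\<exists>K. \<forall>x y. norm (\<phi> x y - \<psi> x y) \<le> norm x * norm y * K" by blast
  then show ?thesis
    using \<phi>.clinear_right \<phi>.clinear_left \<psi>.clinear_right \<psi>.clinear_left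
    by (intro bounded_cbilinear.intro bounded_bilinear.intro bounded_cbilinear_axioms.intro)
      (auto simp: clinear_iff algebra_simps scaleC_complex_def scaleR_right_diff_distrib
        \<phi>.add_left \<phi>.add_right \<psi>.add_left \<psi>.add_right \<phi>.scaleR_left \<phi>.scaleR_right \<psi>.scaleR_left \<psi>.scaleR_right)
qed

lemma clinear_mult_left: "clinear (\<lambda>x. b * x :: 'a::complex_banach_algebra)"
  and clinear_mult_right: "clinear (\<lambda>x. x * b :: 'a::complex_banach_algebra)"
  by (simp_all add: clinear_iff distrib_left distrib_right mult_scaleC_left mult_scaleC_right)

lemma clinear_compose: "clinear f \<Longrightarrow> clinear g \<Longrightarrow> clinear (\<lambda>x. f (g x))"
  by (simp add: clinear_iff)

text \<open>If \<open>a * b = 0\<close>, then \<open>(x, y) \<mapsto> \<phi> (b * x) (y * a)\<close> vanishes on zero products. Zero product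
  determinacy applies to this map, and then once more in the variables \<open>a, b\<close>.\<close>
lemma zpd_two_sided_identity:
  fixes \<phi> :: "'a::complex_banach_algebra \<Rightarrow> 'a \<Rightarrow> complex"
  assumes zpd: "zero_product_determined TYPE('a)"
    and bil: "bounded_cbilinear \<phi>"
    and zero: "\<And>a b. a * b = 0 \<Longrightarrow> b * a = 0 \<Longrightarrow> \<phi> a b = 0"
  shows "\<phi> (b * (x * z)) (y * (a * c)) - \<phi> (b * x) (z * (y * (a * c))) =
    \<phi> (c * (b * (x * z))) (y * a) - \<phi> (c * (b * x)) (z * (y * a))"
proof -
  interpret bounded_cbilinear \<phi> by fact
  note bl = bounded_linear_mult_left bounded_linear_mult_right
    bounded_linear_compose[OF bounded_linear_mult_left bounded_linear_mult_left]
    bounded_linear_compose[OF bounded_linear_mult_right bounded_linear_mult_right]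
  note cl = clinear_mult_left clinear_mult_right
  define \<psi> where "\<psi> a b = \<phi> (b * (x * z)) (y * a) - \<phi> (b * x) (z * (y * a))" for a b
  have \<psi>_zero: "\<psi> a b = 0" if "a * b = 0" for a b
  proof -
    \<comment> \<open>With \<open>a\<close> and \<open>b\<close> fixed, balancedness in
      \<open>x\<close> and \<open>y\<close> moves \<open>z\<close> from the first argument to the
      second.\<close>
    have "\<phi> (b * (x * z)) (y * a) = \<phi> (b * x) (z * y * a)"
    proof -
      have "bounded_cbilinear (\<lambda>x y. \<phi> (b * x) (y * a))"
        by (intro comp_mult bl cl)
      then show ?thesis
      proof (rule zpd_balanced[OF zpd])
        fix x y :: 'a assume "x * y = 0"
        \<comment> \<open>One product contains \<open>x * y\<close> in the middle, the reversed one
          contains \<open>a * b\<close>.\<close>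
        then show "\<phi> (b * x) (y * a) = 0"
          using that by (intro zero) (metis mult.assoc mult_zero_left mult_zero_right)+
      qed
    qed
    then show ?thesis by (simp add: \<psi>_def mult.assoc)
  qed
  \<comment> \<open>The variable \<open>b\<close> sits in the first slot of \<open>\<phi>\<close>
    and \<open>a\<close> in the second, so bilinearity is obtained for the flipped map
    first.\<close>
  have "bounded_cbilinear (\<lambda>b a. \<psi> a b)"
    unfolding \<psi>_def
    by (intro bounded_cbilinear_diff comp_mult bl cl clinear_compose[OF cl(1) cl(1)])
  then have "bounded_cbilinear \<psi>"
    by (simp add: bounded_cbilinear_def bounded_cbilinear_axioms_def bounded_bilinear.flip)
  then have "\<psi> (a * c) b = \<psi> a (c * b)"
    by (rule zpd_balanced[OF zpd]) (rule \<psi>_zero)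
  then show ?thesis by (simp add: \<psi>_def mult.assoc)
qed

text \<open>The outer factors \<open>b\<close> and \<open>y\<close> of
  \<open>zpd_two_sided_identity\<close> run through the approximate identity, one after the other,
  and disappear in the limit.\<close>

lemma (in approximate_identity) two_sided_identity:
  fixes \<phi> :: "'a \<Rightarrow> 'a \<Rightarrow> complex"
  assumes zpd: "zero_product_determined TYPE('a)"
    and bil: "bounded_cbilinear \<phi>"
    and zero: "\<And>a b. a * b = 0 \<Longrightarrow> b * a = 0 \<Longrightarrow> \<phi> a b = 0"
  shows "\<phi> (u * z) (v * c) - \<phi> u (z * (v * c)) = \<phi> (c * (u * z)) v - \<phi> (c * u) (z * v)"
proof -
  interpret bounded_cbilinear \<phi> by fact
  have *: "\<phi> (u * z) (y * (v * c)) - \<phi> u (z * (y * (v * c))) =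
      \<phi> (c * (u * z)) (y * v) - \<phi> (c * u) (z * (y * v))" for y
  proof (rule tendsto_unique[OF nontrivial])
    have eq: "\<phi> (e * (u * z)) (y * (v * c)) - \<phi> (e * u) (z * (y * (v * c))) =
        \<phi> (c * (e * (u * z))) (y * v) - \<phi> (c * (e * u)) (z * (y * v))" for e
      by (rule zpd_two_sided_identity[OF zpd bil zero])
    show "((\<lambda>e. \<phi> (e * (u * z)) (y * (v * c)) - \<phi> (e * u) (z * (y * (v * c)))) \<longlongrightarrow>
        \<phi> (u * z) (y * (v * c)) - \<phi> u (z * (y * (v * c)))) F"
      by (intro tendsto_diff tendsto left tendsto_const)
    show "((\<lambda>e. \<phi> (e * (u * z)) (y * (v * c)) - \<phi> (e * u) (z * (y * (v * c)))) \<longlongrightarrow>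
        \<phi> (c * (u * z)) (y * v) - \<phi> (c * u) (z * (y * v))) F"
      unfolding eq
      by (intro tendsto_diff tendsto tendsto_mult_left left tendsto_const)
  qed
  show ?thesis
  proof (rule tendsto_unique[OF nontrivial])
    show "((\<lambda>e. \<phi> (u * z) (e * (v * c)) - \<phi> u (z * (e * (v * c)))) \<longlongrightarrow>
        \<phi> (u * z) (v * c) - \<phi> u (z * (v * c))) F"
      by (intro tendsto_diff tendsto tendsto_mult_left left tendsto_const)
    show "((\<lambda>e. \<phi> (u * z) (e * (v * c)) - \<phi> u (z * (e * (v * c)))) \<longlongrightarrow>
        \<phi> (c * (u * z)) v - \<phi> (c * u) (z * v)) F"
      unfolding *
      by (intro tendsto_diff tendsto tendsto_mult_left left tendsto_const)
  qed
qed

text \<open>The identity above gives the limit on triple products; these are dense, and the functionals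
  \<open>\<phi> e\<close> are equibounded.\<close>
lemma (in approximate_identity) left_limit:
  fixes \<phi> :: "'a \<Rightarrow> 'a \<Rightarrow> complex"
  assumes zpd: "zero_product_determined TYPE('a)"
    and bil: "bounded_cbilinear \<phi>"
    and zero: "\<And>a b. a * b = 0 \<Longrightarrow> b * a = 0 \<Longrightarrow> \<phi> a b = 0"
  obtains \<mu> where "\<And>v. ((\<lambda>e. \<phi> e v) \<longlongrightarrow> \<mu> v) F"
    "\<And>z v c. \<mu> (z * (v * c)) = \<phi> z (v * c) - \<phi> (c * z) v + \<phi> c (z * v)"
proof -
  interpret bounded_cbilinear \<phi> by fact
  have prod: "((\<lambda>e. \<phi> e (z * (v * c))) \<longlongrightarrow> \<phi> z (v * c) - \<phi> (c * z) v + \<phi> c (z * v)) F" for z v c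
  proof -
    \<comment> \<open>The identity with \<open>u = e\<close>, solved for one term; the other three
      terms converge because \<open>e * z\<close> tends to \<open>z\<close> and \<open>c * e\<close>
      to \<open>c\<close>.\<close>
    have eq: "\<phi> e (z * (v * c)) = \<phi> (e * z) (v * c) - \<phi> (c * (e * z)) v + \<phi> (c * e) (z * v)" for e
      using two_sided_identity[OF assms, of e z v c] by (simp add: algebra_simps)
    show ?thesis
      unfolding eq by (intro tendsto_diff tendsto_add tendsto tendsto_mult_left left right tendsto_const)
  qed
  define conv where "conv v = (\<exists>l. ((\<lambda>e. \<phi> e v) \<longlongrightarrow> l) F)" for v
  obtain K where K: "0 \<le> K" "\<And>x y. norm (\<phi> x y) \<le> norm x * norm y * K"
    using nonneg_bounded by blast
  have closed: "conv v" if h: "(h \<longlongrightarrow> v) F" and conv: "\<And>d. conv (h d)" for h :: "'a \<Rightarrow> 'a" and v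
    unfolding conv_def
  proof (rule filter_limit_exists_approx[OF nontrivial])
    fix r :: real assume "0 < r"
    \<comment> \<open>Equiboundedness costs a factor \<open>C * K\<close>; the added
      \<open>1\<close> keeps the denominator positive and the estimate strict.\<close>
    define s where "s = r / (C * K + 1)"
    have "0 < C * K + 1" using C_nonneg K(1) by (simp add: add_nonneg_pos)
    then have "0 < s" using \<open>0 < r\<close> by (simp add: s_def)
    then obtain d where d: "dist (h d) v < s"
      using eventually_happens'[OF nontrivial tendstoD[OF h]] by blast
    obtain l where "((\<lambda>e. \<phi> e (h d)) \<longlongrightarrow> l) F" using conv[of d] by (auto simp: conv_def)
    moreover have "\<forall>\<^sub>F e in F. dist (\<phi> e v) (\<phi> e (h d)) < r"
      using norm_le
    proof eventually_elim
      case (elim e)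
      have "dist (\<phi> e v) (\<phi> e (h d)) = norm (\<phi> e (v - h d))" by (simp add: diff_right dist_norm)
      also have "\<dots> \<le> norm e * norm (v - h d) * K" by (rule K)
      also have "\<dots> \<le> C * s * K"
        using elim d \<open>0 < s\<close> C_nonneg K(1)
        by (intro mult_mono) (auto simp: dist_norm norm_minus_commute)
      also have "\<dots> < (C * K + 1) * s" using \<open>0 < s\<close> by (simp add: algebra_simps)
      also have "\<dots> = r" using \<open>0 < C * K + 1\<close> by (simp add: s_def)
      finally show ?case .
    qed
    ultimately show "\<exists>g l. (g \<longlongrightarrow> l) F \<and> (\<forall>\<^sub>F e in F. dist (\<phi> e v) (g e) < r)" by blast
  qed
  have "conv (z * (v * c))" for z v c using prod by (auto simp: conv_def)
  \<comment> \<open>The approximate identity first replaces \<open>c\<close>, then \<open>z\<close>,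
    so convergence descends from triple products to products and to all of the algebra.\<close>
  then have "conv (z * v)" for z v
    by (rule closed[of "\<lambda>e. z * (v * e)", rotated]) (intro tendsto_mult_left right)
  then have "conv v" for v
    by (rule closed[of "\<lambda>e. e * v", rotated]) (rule left)
  then obtain \<mu> where \<mu>: "\<And>v. ((\<lambda>e. \<phi> e v) \<longlongrightarrow> \<mu> v) F"
    unfolding conv_def by metis
  then have "\<mu> (z * (v * c)) = \<phi> z (v * c) - \<phi> (c * z) v + \<phi> c (z * v)" for z v c
    using tendsto_unique[OF nontrivial _ prod] by blast
  with \<mu> show thesis by (rule that)
qed

text \<open>If \<open>\<omega>\<close> implements the derivation \<open>D\<close>, then
  \<open>\<sigma> = - \<omega>\<close> and \<open>\<tau> = \<mu> + \<omega>\<close> represent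
  \<open>\<phi>\<close>.\<close>

lemma (in approximate_identity) two_sided_zero_product_functional:
  fixes \<phi> :: "'a \<Rightarrow> 'a \<Rightarrow> complex"
  assumes zpd: "zero_product_determined TYPE('a)"
    and wa: "weakly_amenable TYPE('a)"
    and bil: "bounded_cbilinear \<phi>"
    and zero: "\<And>a b. a * b = 0 \<Longrightarrow> b * a = 0 \<Longrightarrow> \<phi> a b = 0"
  obtains \<sigma> \<tau> where "bounded_linear \<sigma>" "bounded_linear \<tau>" "\<And>a b. \<phi> a b = \<sigma> (a * b) + \<tau> (b * a)"
proof -
  interpret bounded_cbilinear \<phi> by fact
  obtain \<mu> where lim: "\<And>v. ((\<lambda>e. \<phi> e v) \<longlongrightarrow> \<mu> v) F"
    and \<mu>: "\<And>z v c. \<mu> (z * (v * c)) = \<phi> z (v * c) - \<phi> (c * z) v + \<phi> c (z * v)"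
    using left_limit[OF zpd bil zero] by blast
  obtain K where K: "0 \<le> K" "\<And>x y. norm (\<phi> x y) \<le> norm x * norm y * K"
    using nonneg_bounded by blast
  have \<mu>_add: "\<mu> (x + y) = \<mu> x + \<mu> y" for x y
    using tendsto_unique[OF nontrivial lim[of "x + y"]] tendsto_add[OF lim lim]
    by (simp add: add_right)
  have "((\<lambda>e. c * \<phi> e x) \<longlongrightarrow> c * \<mu> x) F" for c x
    by (intro tendsto_mult_left lim)
  then have \<mu>_scaleC: "\<mu> (c *\<^sub>C x) = c *\<^sub>C \<mu> x" for c x
    using tendsto_unique[OF nontrivial lim[of "c *\<^sub>C x"]]
    by (simp add: clinear_scaleC[OF clinear_right] scaleC_complex_def)
  have cl: "clinear \<mu>" by (simp add: clinear_iff \<mu>_add \<mu>_scaleC)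
  \<comment> \<open>The bound \<open>C * K\<close>, valid eventually for the functionals
    \<open>\<phi> e\<close>, survives the pointwise limit.\<close>
  have \<mu>_le: "norm (\<mu> v) \<le> norm v * (C * K)" for v
  proof (rule tendsto_upperbound[OF tendsto_norm[OF lim] _ nontrivial])
    show "\<forall>\<^sub>F e in F. norm (\<phi> e v) \<le> norm v * (C * K)"
      using norm_le
    proof eventually_elim
      case (elim e)
      have "norm e * norm v * K \<le> C * norm v * K"
        using elim K(1) by (intro mult_right_mono) auto
      then show ?case using K(2)[of e v] by (simp add: mult_ac)
    qed
  qed
  then have bl: "bounded_linear \<mu>"
    using \<mu>_le clinear_imp_linear[OF cl]
    by (intro bounded_linear_intro[of _ "C * K"]) (auto simp: \<mu>_add linear_scale)
  define D where "D a = Blinfun (\<lambda>v. \<phi> a v - \<mu> (v * a))" for a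
  have D: "blinfun_apply (D a) v = \<phi> a v - \<mu> (v * a)" for a v
  proof -
    have "bounded_linear (\<lambda>v. \<phi> a v - \<mu> (v * a))"
      by (intro bounded_linear_sub bounded_linear_right
          bounded_linear_compose[OF bl bounded_linear_mult_left])
    then show ?thesis by (simp add: D_def bounded_linear_Blinfun_apply)
  qed
  have "bounded_linear D"
  proof (rule bounded_linear_intro)
    fix x y :: 'a and r :: real
    show "D (x + y) = D x + D y"
      by (rule blinfun_eqI) (simp add: D blinfun.add_left add_left \<mu>_add distrib_left)
    show "D (r *\<^sub>R x) = r *\<^sub>R D x"
      using linear_scale[OF bounded_linear.linear[OF bl]]
      by (intro blinfun_eqI) (simp add: D blinfun.scaleR_left scaleR_left algebra_simps)
    show "norm (D x) \<le> norm x * (K + C * K)"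
    proof (rule norm_blinfun_bound)
      fix v
      have "norm (\<mu> (v * x)) \<le> norm (v * x) * (C * K)" by (rule \<mu>_le)
      also have "\<dots> \<le> norm v * norm x * (C * K)"
        using norm_mult_ineq C_nonneg K(1) by (intro mult_right_mono) auto
      finally show "norm (blinfun_apply (D x) v) \<le> norm x * (K + C * K) * norm v"
        using K(2)[of x v] norm_triangle_ineq4[of "\<phi> x v" "\<mu> (v * x)"]
        by (simp add: D algebra_simps)
    qed (use C_nonneg K(1) in auto)
  qed
  moreover have "dual_derivation D"
    unfolding dual_derivation_def
  proof (intro conjI allI)
    show "range D \<subseteq> cdual"
      using clinear_right
      by (auto simp: cdual_def clinear_iff D \<mu>_add \<mu>_scaleC distrib_right mult_scaleC_left
          scaleC_complex_def algebra_simps)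
    have "D (c *\<^sub>C x) = c *\<^sub>C D x" for c x
      by (rule blinfun_eqI) (simp add: D clinear_scaleC[OF clinear_left] scaleC_blinfun.rep_eq
          mult_scaleC_right \<mu>_scaleC scaleC_complex_def algebra_simps)
    then show "clinear D"
      using linear_add[OF bounded_linear.linear[OF \<open>bounded_linear D\<close>]] by (simp add: clinear_iff)
    fix a b
    \<comment> \<open>Evaluated at \<open>v\<close>, the Leibniz rule is the formula for
      \<open>\<mu>\<close> at the triple product \<open>b * (v * a)\<close>.\<close>
    show "D (a * b) = dual_left_act a (D b) + dual_right_act (D a) b"
      using \<mu>[of b _ a]
      by (intro blinfun_eqI)
        (simp add: D blinfun.add_left dual_left_act_apply dual_right_act_apply mult.assoc)
  qed
  ultimately obtain \<omega> where "\<And>a. D a = dual_left_act a \<omega> - dual_right_act \<omega> a"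
    using wa linear_continuous_on[of D UNIV] by (auto simp: weakly_amenable_def)
  then have "\<phi> a b - \<mu> (b * a) = blinfun_apply \<omega> (b * a) - blinfun_apply \<omega> (a * b)" for a b
    by (metis D blinfun.diff_left dual_left_act_apply dual_right_act_apply)
  then have "\<phi> a b = - blinfun_apply \<omega> (a * b) + (\<mu> (b * a) + blinfun_apply \<omega> (b * a))" for a b
    by (simp add: algebra_simps)
  then show thesis
    by (intro that[of "\<lambda>x. - blinfun_apply \<omega> x" "\<lambda>x. \<mu> x + blinfun_apply \<omega> x"])
      (auto intro!: bounded_linear_minus bounded_linear_add bl blinfun.bounded_linear_right)
qed

section \<open>The weight of a two-sided zero product preserver\<close>

lemma zero_if_functionals_zero:
  fixes a :: "'a::complex_normed_vector"
  assumes "\<And>\<xi>. clinear \<xi> \<Longrightarrow> (\<And>x. cmod (\<xi> x) \<le> norm x) \<Longrightarrow> \<xi> a = 0"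
  shows "a = 0"
  using norming_functional[of a] assms by (metis norm_eq_zero of_real_eq_0_iff)

lemma contraction_bounded_linear:
  fixes \<xi> :: "'a::complex_normed_vector \<Rightarrow> complex"
  assumes "clinear \<xi>" "\<And>x. cmod (\<xi> x) \<le> norm x"
  shows "bounded_linear \<xi>"
  using clinear_imp_linear[OF assms(1)] assms(2)
  by (intro bounded_linear_intro[of _ 1]) (auto simp: linear_add linear_scale)

lemma bounded_bilinear_contraction_mult:
  fixes \<xi> :: "'a::complex_banach_algebra \<Rightarrow> complex"
  assumes \<xi>: "clinear \<xi>" "\<And>x. cmod (\<xi> x) \<le> norm x"
  shows "bounded_bilinear (\<lambda>x y. \<xi> (x * y))"
proof -
  interpret \<xi>: bounded_linear \<xi> using contraction_bounded_linear[OF \<xi>] .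
  have "cmod (\<xi> (x * y)) \<le> norm x * norm y * 1" for x y
    using order_trans[OF \<xi>(2) norm_mult_ineq] by simp
  then have "\<exists>K. \<forall>x y. cmod (\<xi> (x * y)) \<le> norm x * norm y * K" by blast
  then show ?thesis
    by unfold_locales (auto simp: \<xi>.add \<xi>.scaleR distrib_left distrib_right)
qed

lemma bounded_bilinear_jordan_prod: "bounded_bilinear jordan_prod"
proof (intro bounded_bilinear.intro exI allI)
  fix a b :: "'a::complex_banach_algebra"
  have "norm (jordan_prod a b) \<le> norm (a * b) + norm (b * a)"
    unfolding jordan_prod_def by (rule norm_triangle_ineq)
  also have "\<dots> \<le> norm a * norm b * 2"
    using norm_mult_ineq[of a b] norm_mult_ineq[of b a] by (simp add: mult.commute)
  finally show "norm (jordan_prod a b) \<le> norm a * norm b * 2" .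
qed (simp_all add: jordan_prod_def algebra_simps)

interpretation jordan: bounded_bilinear jordan_prod
  by (rule bounded_bilinear_jordan_prod)

lemma (in approximate_identity) tendsto_jordan_prod:
  "((\<lambda>e. jordan_prod a e) \<longlongrightarrow> 2 *\<^sub>R a) F"
  unfolding jordan_prod_def scaleR_2 by (intro tendsto_add left right)

text \<open>As \<open>a * e\<close> tends to \<open>a\<close>, an identity in the algebra may be
  checked after multiplication on the right by arbitrary elements.\<close>

lemma (in approximate_identity) eq_zero_if_mult_zero:
  fixes a :: 'a
  assumes "\<And>x. a * x = 0"
  shows "a = 0"
  using tendsto_unique[OF nontrivial right[of a]] assms by simp

text \<open>Zero product determinacy, weak amenability and the zero product condition enter only
  through \<open>functional\<close>, where \<open>\<sigma>\<close> and \<open>\<tau>\<close> may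
  depend on \<open>\<xi>\<close>.\<close>

locale zero_product_map = approximate_identity F C
  for F :: "'a::complex_banach_algebra filter" and C :: real +
  fixes \<Phi> :: "'a \<Rightarrow> 'b::complex_banach_algebra"
  assumes \<Phi>: "bounded_linear \<Phi>" and \<Phi>_clinear: "clinear \<Phi>"
    and functional: "\<And>\<xi>. clinear \<xi> \<Longrightarrow> (\<And>x. cmod (\<xi> x) \<le> norm x) \<Longrightarrow>
      \<exists>\<sigma> \<tau>. bounded_linear \<sigma> \<and> bounded_linear \<tau> \<and>
        (\<forall>a b. \<xi> (\<Phi> a * \<Phi> b) = \<sigma> (a * b) + \<tau> (b * a))"
begin

interpretation \<Phi>: bounded_linear \<Phi> by (rule \<Phi>)

text \<open>Symmetrizing merges \<open>\<sigma>\<close> and \<open>\<tau>\<close> into their sum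
  \<open>\<rho>\<close>; putting \<open>e\<close> into either slot gives the same limit.\<close>

lemma functional_jordan:
  assumes \<xi>: "clinear \<xi>" "\<And>x. cmod (\<xi> x) \<le> norm x"
  obtains \<rho> where "bounded_linear \<rho>" "\<And>a b. \<xi> (jordan_prod (\<Phi> a) (\<Phi> b)) = \<rho> (jordan_prod a b)"
    "\<And>a. ((\<lambda>e. \<xi> (\<Phi> a * \<Phi> e)) \<longlongrightarrow> \<rho> a) F" "\<And>a. ((\<lambda>e. \<xi> (\<Phi> e * \<Phi> a)) \<longlongrightarrow> \<rho> a) F"
proof -
  obtain \<sigma> \<tau> where bl: "bounded_linear \<sigma>" "bounded_linear \<tau>"
    and eq: "\<And>a b. \<xi> (\<Phi> a * \<Phi> b) = \<sigma> (a * b) + \<tau> (b * a)"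
    using functional[OF \<xi>] by blast
  interpret \<sigma>: bounded_linear \<sigma> by fact
  interpret \<tau>: bounded_linear \<tau> by fact
  show thesis
  proof
    show "bounded_linear (\<lambda>x. \<sigma> x + \<tau> x)" by (intro bounded_linear_add bl)
    show "\<xi> (jordan_prod (\<Phi> a) (\<Phi> b)) = \<sigma> (jordan_prod a b) + \<tau> (jordan_prod a b)" for a b
      by (simp add: jordan_prod_def clinear_add[OF \<xi>(1)] eq \<sigma>.add \<tau>.add)
    show "((\<lambda>e. \<xi> (\<Phi> a * \<Phi> e)) \<longlongrightarrow> \<sigma> a + \<tau> a) F" "((\<lambda>e. \<xi> (\<Phi> e * \<Phi> a)) \<longlongrightarrow> \<sigma> a + \<tau> a) F" for a
      unfolding eq by (intro tendsto_add \<sigma>.tendsto \<tau>.tendsto left right)+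
  qed
qed

text \<open>A functional norming the difference reduces the claim to a bound on
  \<open>\<rho>\<close>. As a limit of \<open>\<xi> (\<Phi> x * \<Phi> e)\<close>,
  \<open>\<rho>\<close> is bounded by \<open>M * (C * M)\<close>, whatever \<open>\<xi>\<close>
  is.\<close>

lemma jordan_prod_dominated:
  obtains K where "0 \<le> K" "\<And>a b c d. dist (jordan_prod (\<Phi> a) (\<Phi> b)) (jordan_prod (\<Phi> c) (\<Phi> d)) \<le>
    K * dist (jordan_prod a b) (jordan_prod c d)"
proof -
  obtain M where M: "0 \<le> M" "\<And>x. norm (\<Phi> x) \<le> norm x * M" using \<Phi>.nonneg_bounded by blast
  define K where "K = M * (C * M)"
  have "dist (jordan_prod (\<Phi> a) (\<Phi> b)) (jordan_prod (\<Phi> c) (\<Phi> d)) \<le>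
      K * dist (jordan_prod a b) (jordan_prod c d)" for a b c d
  proof -
    define y where "y = jordan_prod (\<Phi> a) (\<Phi> b) - jordan_prod (\<Phi> c) (\<Phi> d)"
    obtain \<xi> :: "'b \<Rightarrow> complex" where \<xi>: "clinear \<xi>" "\<xi> y = complex_of_real (norm y)" "\<And>x. cmod (\<xi> x) \<le> norm x"
      using norming_functional[of y] by blast
    obtain \<rho> where \<rho>: "bounded_linear \<rho>" "\<And>a b. \<xi> (jordan_prod (\<Phi> a) (\<Phi> b)) = \<rho> (jordan_prod a b)"
      "\<And>a. ((\<lambda>e. \<xi> (\<Phi> a * \<Phi> e)) \<longlongrightarrow> \<rho> a) F" "\<And>a. ((\<lambda>e. \<xi> (\<Phi> e * \<Phi> a)) \<longlongrightarrow> \<rho> a) F"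
      by (rule functional_jordan[OF \<xi>(1,3)], rule that)
    have \<rho>_le: "cmod (\<rho> x) \<le> K * norm x" for x
    proof (rule tendsto_upperbound[OF tendsto_norm[OF \<rho>(3)] _ nontrivial])
      show "\<forall>\<^sub>F e in F. cmod (\<xi> (\<Phi> x * \<Phi> e)) \<le> K * norm x"
        using norm_le
      proof eventually_elim
        case (elim e)
        have "cmod (\<xi> (\<Phi> x * \<Phi> e)) \<le> norm (\<Phi> x) * norm (\<Phi> e)"
          by (rule order_trans[OF \<xi>(3) norm_mult_ineq])
        also have "\<dots> \<le> (norm x * M) * (norm e * M)"
          using M by (intro mult_mono) auto
        also have "\<dots> \<le> (norm x * M) * (C * M)"
          using M elim by (intro mult_left_mono mult_right_mono) auto
        finally show ?case by (simp add: K_def mult_ac)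
      qed
    qed
    have "complex_of_real (norm y) = \<rho> (jordan_prod a b - jordan_prod c d)"
      using \<xi>(2) linear_diff[OF clinear_imp_linear[OF \<xi>(1)]] linear_diff[OF bounded_linear.linear[OF \<rho>(1)]] \<rho>(2)
      by (simp add: y_def)
    then have "norm y = cmod (\<rho> (jordan_prod a b - jordan_prod c d))"
      by (metis norm_ge_zero norm_of_real abs_of_nonneg)
    then show ?thesis using \<rho>_le by (simp add: dist_norm y_def)
  qed
  then show thesis using that[of K] M C_nonneg by (simp add: K_def)
qed

text \<open>In the unital case \<open>S a = \<Phi> 1 * \<Phi> a\<close>.\<close>
definition S :: "'a \<Rightarrow> 'b"
  where "S a = Lim F (\<lambda>e. (1/2) *\<^sub>R jordan_prod (\<Phi> a) (\<Phi> e))"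

text \<open>Since \<open>jordan_prod a e\<close> tends to \<open>2 a\<close>, domination makes the
  images converge, and only then does \<open>Lim\<close> denote their limit.\<close>

lemma tendsto_S: "((\<lambda>e. (1/2) *\<^sub>R jordan_prod (\<Phi> a) (\<Phi> e)) \<longlongrightarrow> S a) F"
proof -
  obtain K where "0 \<le> K" "\<And>a b c d. dist (jordan_prod (\<Phi> a) (\<Phi> b)) (jordan_prod (\<Phi> c) (\<Phi> d)) \<le>
    K * dist (jordan_prod a b) (jordan_prod c d)"
    using jordan_prod_dominated by blast
  then obtain l where "((\<lambda>e. jordan_prod (\<Phi> a) (\<Phi> e)) \<longlongrightarrow> l) F"
    using filter_limit_exists_dominated[OF nontrivial tendsto_jordan_prod, of K "\<lambda>e. jordan_prod (\<Phi> a) (\<Phi> e)" a] by blast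
  then have lim: "((\<lambda>e. (1/2) *\<^sub>R jordan_prod (\<Phi> a) (\<Phi> e)) \<longlongrightarrow> (1/2) *\<^sub>R l) F"
    by (intro tendsto_scaleR tendsto_const)
  show ?thesis unfolding S_def tendsto_Lim[OF nontrivial lim] by (rule lim)
qed

text \<open>The functional \<open>\<rho>\<close> is \<open>\<xi>\<close> composed with
  \<open>S\<close>: at \<open>jordan_prod x e\<close> the limit \<open>2 x\<close> cancels the
  factor \<open>1/2\<close> in \<open>S\<close>.\<close>

lemma functional_S:
  assumes \<xi>: "clinear \<xi>" "\<And>x. cmod (\<xi> x) \<le> norm x"
  shows "\<xi> (jordan_prod (\<Phi> a) (\<Phi> b)) = \<xi> (S (jordan_prod a b))"
    and "((\<lambda>e. \<xi> (\<Phi> a * \<Phi> e)) \<longlongrightarrow> \<xi> (S a)) F"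
    and "((\<lambda>e. \<xi> (\<Phi> e * \<Phi> a)) \<longlongrightarrow> \<xi> (S a)) F"
proof -
  interpret \<xi>: bounded_linear \<xi> using contraction_bounded_linear[OF \<xi>] .
  obtain \<rho> where \<rho>: "bounded_linear \<rho>" "\<And>a b. \<xi> (jordan_prod (\<Phi> a) (\<Phi> b)) = \<rho> (jordan_prod a b)"
    "\<And>a. ((\<lambda>e. \<xi> (\<Phi> a * \<Phi> e)) \<longlongrightarrow> \<rho> a) F" "\<And>a. ((\<lambda>e. \<xi> (\<Phi> e * \<Phi> a)) \<longlongrightarrow> \<rho> a) F"
    by (rule functional_jordan[OF \<xi>], rule that)
  interpret \<rho>: bounded_linear \<rho> by fact
  have \<rho>_S: "\<xi> (S x) = \<rho> x" for x
  proof (rule tendsto_unique[OF nontrivial \<xi>.tendsto[OF tendsto_S]])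
    have "((\<lambda>e. (1/2) *\<^sub>R \<rho> (jordan_prod x e)) \<longlongrightarrow> (1/2) *\<^sub>R \<rho> (2 *\<^sub>R x)) F"
      by (intro tendsto_scaleR tendsto_const \<rho>.tendsto tendsto_jordan_prod)
    then show "((\<lambda>e. \<xi> ((1/2) *\<^sub>R jordan_prod (\<Phi> x) (\<Phi> e))) \<longlongrightarrow> \<rho> x) F"
      by (simp add: \<xi>.scaleR \<rho>(2) \<rho>.scaleR)
  qed
  show "\<xi> (jordan_prod (\<Phi> a) (\<Phi> b)) = \<xi> (S (jordan_prod a b))"
    "((\<lambda>e. \<xi> (\<Phi> a * \<Phi> e)) \<longlongrightarrow> \<xi> (S a)) F" "((\<lambda>e. \<xi> (\<Phi> e * \<Phi> a)) \<longlongrightarrow> \<xi> (S a)) F"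
    by (simp_all add: \<rho>_S \<rho>)
qed

lemma S_jordan_prod: "S (jordan_prod a b) = jordan_prod (\<Phi> a) (\<Phi> b)"
proof -
  have "S (jordan_prod a b) - jordan_prod (\<Phi> a) (\<Phi> b) = 0"
    by (rule zero_if_functionals_zero)
      (simp add: functional_S(1) linear_diff[OF clinear_imp_linear])
  then show ?thesis by simp
qed

lemma clinear_S: "clinear S"
proof -
  have "S (x + y) = S x + S y" for x y
    using tendsto_unique[OF nontrivial tendsto_S[of "x + y"]] tendsto_add[OF tendsto_S[of x] tendsto_S[of y]]
    by (simp add: \<Phi>.add jordan.add_left scaleR_add_right)
  moreover have "S (c *\<^sub>C x) = c *\<^sub>C S x" for c x
  proof (rule tendsto_unique[OF nontrivial tendsto_S[of "c *\<^sub>C x"]])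
    have "((\<lambda>e. c *\<^sub>C (1/2) *\<^sub>R jordan_prod (\<Phi> x) (\<Phi> e)) \<longlongrightarrow> c *\<^sub>C S x) F"
      by (intro bounded_linear.tendsto[OF bounded_linear_scaleC] tendsto_S)
    then show "((\<lambda>e. (1/2) *\<^sub>R jordan_prod (\<Phi> (c *\<^sub>C x)) (\<Phi> e)) \<longlongrightarrow> c *\<^sub>C S x) F"
      by (simp add: clinear_scaleC[OF \<Phi>_clinear] jordan_prod_def mult_scaleC_left mult_scaleC_right
          scaleC_scaleR_commute flip: scaleC_add_right)
  qed
  ultimately show ?thesis by (simp add: clinear_iff)
qed

text \<open>This makes \<open>S\<close> factor through \<open>\<Phi>\<close>.\<close>

lemma S_eq_zero: "\<Phi> a = 0 \<Longrightarrow> S a = 0"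
  using tendsto_unique[OF nontrivial tendsto_S[of a]] by (simp add: jordan.zero_left)

text \<open>Both sides are the weak limit of \<open>\<Phi> a * \<Phi> e * \<Phi> b\<close>.\<close>
lemma S_mult_commute: "S a * \<Phi> b = \<Phi> a * S b"
proof -
  have "S a * \<Phi> b - \<Phi> a * S b = 0"
  proof (rule zero_if_functionals_zero)
    fix \<xi> :: "'b \<Rightarrow> complex"
    assume \<xi>: "clinear \<xi>" "\<And>x. cmod (\<xi> x) \<le> norm x"
    interpret \<xi>: bounded_linear \<xi> using contraction_bounded_linear[OF \<xi>] .
    \<comment> \<open>The composite of \<open>\<xi>\<close> and \<open>f\<close> need not be a
      contraction, so it is divided by \<open>M\<close> before \<open>functional_S\<close>
      applies.\<close>
    have scaled: "((\<lambda>e. \<xi> (f (\<Phi> x * \<Phi> e))) \<longlongrightarrow> \<xi> (f (S x))) F \<and>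
        ((\<lambda>e. \<xi> (f (\<Phi> e * \<Phi> x))) \<longlongrightarrow> \<xi> (f (S x))) F"
      if f: "clinear f" "0 < M" "\<And>x. norm (f x) \<le> M * norm x" for f :: "'b \<Rightarrow> 'b" and M x
    proof -
      define \<eta> where "\<eta> y = (1/M) *\<^sub>R \<xi> (f y)" for y
      have \<eta>: "clinear \<eta>"
        using f(1) \<xi>(1) by (simp add: \<eta>_def clinear_iff scaleC_complex_def scaleR_right_distrib)
      have \<eta>_le: "cmod (\<eta> y) \<le> norm y" for y
        using order_trans[OF \<xi>(2) f(3), of y] \<open>0 < M\<close> by (simp add: \<eta>_def field_simps)
      have "\<xi> (f y) = M *\<^sub>R \<eta> y" for y using \<open>0 < M\<close> by (simp add: \<eta>_def)
      then show ?thesis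
        using functional_S(2,3)[OF \<eta> \<eta>_le, of x] by (simp only:) (intro conjI tendsto_scaleR tendsto_const)
    qed
    have "((\<lambda>e. \<xi> (\<Phi> a * \<Phi> e * \<Phi> b)) \<longlongrightarrow> \<xi> (S a * \<Phi> b)) F"
    proof -
      \<comment> \<open>The added \<open>1\<close> makes the bound strictly positive even if
        \<open>\<Phi> b = 0\<close>.\<close>
      have "norm (y * \<Phi> b) \<le> (norm (\<Phi> b) + 1) * norm y" for y
        using norm_mult_ineq[of y "\<Phi> b"] by (simp add: algebra_simps add_increasing)
      then show ?thesis
        using scaled[OF clinear_mult_right[of "\<Phi> b"], of "norm (\<Phi> b) + 1"] by (simp add: add_nonneg_pos)
    qed
    moreover have "((\<lambda>e. \<xi> (\<Phi> a * \<Phi> e * \<Phi> b)) \<longlongrightarrow> \<xi> (\<Phi> a * S b)) F"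
    proof -
      have "norm (\<Phi> a * y) \<le> (norm (\<Phi> a) + 1) * norm y" for y
        using norm_mult_ineq[of "\<Phi> a" y] by (simp add: algebra_simps add_increasing)
      then show ?thesis
        using scaled[OF clinear_mult_left[of "\<Phi> a"], of "norm (\<Phi> a) + 1"]
        by (simp add: add_nonneg_pos mult.assoc)
    qed
    ultimately show "\<xi> (S a * \<Phi> b - \<Phi> a * S b) = 0"
      using tendsto_unique[OF nontrivial] by (simp add: \<xi>.diff)
  qed
  then show ?thesis by simp
qed

end

section \<open>The weight as an invertible centralizer of the target algebra\<close>

locale zero_product_surjection = zero_product_map F C \<Phi> + B: approximate_identity G C'
  for F :: "'a::complex_banach_algebra filter" and C
    and \<Phi> :: "'a \<Rightarrow> 'b::complex_banach_algebra" and G :: "'b filter" and C' +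
  assumes surj: "surj \<Phi>"
begin

text \<open>\<open>inv \<Phi>\<close> picks an arbitrary preimage; \<open>W_\<Phi>\<close> shows
  that the choice does not matter.\<close>

definition W :: "'b \<Rightarrow> 'b"
  where "W y = S (inv \<Phi> y)"

lemma W_\<Phi>: "W (\<Phi> a) = S a"
proof -
  have "\<Phi> (inv \<Phi> (\<Phi> a) - a) = 0"
    using linear_diff[OF bounded_linear.linear[OF \<Phi>]] surj by (simp add: surj_f_inv_f)
  from S_eq_zero[OF this] show ?thesis
    using linear_diff[OF clinear_imp_linear[OF clinear_S]] by (simp add: W_def)
qed

lemma ex_preimage: "\<exists>a. y = \<Phi> a"
  using surj by blast

lemma clinear_W: "clinear W"
  unfolding clinear_iff
proof (intro conjI allI)
  fix x y :: 'b and c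
  obtain a b where ab: "x = \<Phi> a" "y = \<Phi> b" using ex_preimage[of x] ex_preimage[of y] by blast
  show "W (x + y) = W x + W y"
    unfolding ab clinear_add[OF \<Phi>_clinear, symmetric] W_\<Phi> by (rule clinear_add[OF clinear_S])
  show "W (c *\<^sub>C x) = c *\<^sub>C W x"
    unfolding ab clinear_scaleC[OF \<Phi>_clinear, symmetric] W_\<Phi> by (rule clinear_scaleC[OF clinear_S])
qed

lemma W_commute: "W x * y = x * W y"
proof -
  obtain a b where ab: "x = \<Phi> a" "y = \<Phi> b" using ex_preimage[of x] ex_preimage[of y] by blast
  show ?thesis unfolding ab W_\<Phi> by (rule S_mult_commute)
qed

text \<open>After multiplication by \<open>z\<close>, moving \<open>W\<close> across twice gives
  \<open>W (x * y) * z = x * y * W z = x * W y * z\<close>.\<close>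

lemma W_mult_right: "W (x * y) = x * W y"
proof -
  have "W (x * y) - x * W y = 0"
  proof (rule B.eq_zero_if_mult_zero)
    fix z
    have "W (x * y) * z = x * W y * z" by (simp add: W_commute mult.assoc)
    then show "(W (x * y) - x * W y) * z = 0" by (simp add: left_diff_distrib)
  qed
  then show ?thesis by simp
qed

lemma centralizer_W: "centralizer W"
  by (simp add: centralizer_def clinear_W W_mult_right W_commute)

text \<open>Take \<open>t = \<Phi> (jordan_prod a b)\<close> for bounded preimages \<open>a\<close>,
  \<open>b\<close> of \<open>y\<close>, \<open>z\<close>. The constant collects \<open>L\<close> for
  each preimage, \<open>M\<close> for \<open>\<Phi>\<close> and \<open>2\<close> for the two
  products.\<close>

lemma W_preimage_jordan_prod:
  obtains K where "0 \<le> K" "\<And>y z. \<exists>t. W t = jordan_prod y z \<and> norm t \<le> K * (norm y * norm z)"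
proof -
  obtain L where L: "0 \<le> L" "\<And>y. \<exists>x. \<Phi> x = y \<and> norm x \<le> L * norm y"
    using bounded_linear_surj_bounded_preimages[OF \<Phi> surj] by blast
  obtain M where M: "0 \<le> M" "\<And>x. norm (\<Phi> x) \<le> norm x * M"
    using bounded_linear.nonneg_bounded[OF \<Phi>] by blast
  have "\<exists>t. W t = jordan_prod y z \<and> norm t \<le> (2 * L * L * M) * (norm y * norm z)" for y z
  proof -
    obtain a b where a: "\<Phi> a = y" "norm a \<le> L * norm y" and b: "\<Phi> b = z" "norm b \<le> L * norm z"
      using L(2) by metis
    have "norm (jordan_prod a b) \<le> norm (a * b) + norm (b * a)"
      unfolding jordan_prod_def by (rule norm_triangle_ineq)
    also have "\<dots> \<le> 2 * (norm a * norm b)"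
      using norm_mult_ineq[of a b] norm_mult_ineq[of b a] by (simp add: mult.commute)
    also have "\<dots> \<le> 2 * ((L * norm y) * (L * norm z))"
      using a(2) b(2) L(1) by (intro mult_left_mono mult_mono) auto
    finally have "norm (jordan_prod a b) * M \<le> 2 * ((L * norm y) * (L * norm z)) * M"
      using M(1) by (rule mult_right_mono)
    then have "norm (\<Phi> (jordan_prod a b)) \<le> (2 * L * L * M) * (norm y * norm z)"
      using M(2)[of "jordan_prod a b"] by (simp add: mult_ac)
    moreover have "W (\<Phi> (jordan_prod a b)) = jordan_prod y z"
      by (simp add: W_\<Phi> S_jordan_prod a b)
    ultimately show ?thesis by blast
  qed
  with that[of "2 * L * L * M"] L(1) M(1) show thesis by simp
qed

text \<open>Writing \<open>y \<circ> z = W t\<close> gives \<open>x (y \<circ> z) = (W x) t\<close>; now let \<open>y\<close> and then \<open>z\<close> run through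
  the approximate identity.\<close>
lemma W_bounded_below:
  obtains K where "0 \<le> K" "\<And>x. norm x \<le> K * norm (W x)"
proof -
  obtain K where K: "0 \<le> K" "\<And>y z. \<exists>t. W t = jordan_prod y z \<and> norm t \<le> K * (norm y * norm z)"
    using W_preimage_jordan_prod by blast
  have basic: "norm (x * jordan_prod y z) \<le> norm (W x) * (K * (norm y * norm z))" for x y z
  proof -
    obtain t where t: "W t = jordan_prod y z" "norm t \<le> K * (norm y * norm z)" using K(2) by blast
    then have "norm (x * jordan_prod y z) = norm (W x * t)" by (simp add: W_commute)
    also have "\<dots> \<le> norm (W x) * norm t" by (rule norm_mult_ineq)
    also have "\<dots> \<le> norm (W x) * (K * (norm y * norm z))" using t by (intro mult_left_mono) auto
    finally show ?thesis .
  qed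
  have step: "norm (x * (2 *\<^sub>R z)) \<le> norm (W x) * (K * (C' * norm z))" for x z
  proof (rule tendsto_upperbound[OF _ _ B.nontrivial])
    show "((\<lambda>f. norm (x * jordan_prod z f)) \<longlongrightarrow> norm (x * (2 *\<^sub>R z))) G"
      by (intro tendsto_norm tendsto_mult_left B.tendsto_jordan_prod)
    show "\<forall>\<^sub>F f in G. norm (x * jordan_prod z f) \<le> norm (W x) * (K * (C' * norm z))"
      using B.norm_le
    proof eventually_elim
      case (elim f)
      have "norm (W x) * (K * (norm z * norm f)) \<le> norm (W x) * (K * (norm z * C'))"
        using elim K(1) by (intro mult_left_mono) auto
      then show ?case using basic[of x z f] by (simp add: mult_ac)
    qed
  qed
  have "norm (2 *\<^sub>R x) \<le> norm (W x) * (K * (C' * C'))" for x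
  proof (rule tendsto_upperbound[OF _ _ B.nontrivial])
    show "((\<lambda>f. norm (2 *\<^sub>R (x * f))) \<longlongrightarrow> norm (2 *\<^sub>R x)) G"
      by (intro tendsto_norm tendsto_scaleR tendsto_const B.right)
    show "\<forall>\<^sub>F f in G. norm (2 *\<^sub>R (x * f)) \<le> norm (W x) * (K * (C' * C'))"
      using B.norm_le
    proof eventually_elim
      case (elim f)
      have "norm (W x) * (K * (C' * norm f)) \<le> norm (W x) * (K * (C' * C'))"
        using elim K(1) B.C_nonneg by (intro mult_left_mono) auto
      then show ?case using step[of x f] by simp
    qed
  qed
  note le = this
  \<comment> \<open>Of the left side \<open>2 * norm x\<close> only \<open>norm x\<close> is
    kept.\<close>
  have "norm x \<le> (K * (C' * C')) * norm (W x)" for x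
    using le[of x] norm_ge_zero[of x] unfolding norm_scaleR mult.commute[of "norm (W x)"] by linarith
  then show thesis using that[of "K * (C' * C')"] K(1) B.C_nonneg by simp
qed

lemma inj_W: "inj W"
proof -
  obtain K where K: "\<And>x. norm x \<le> K * norm (W x)" using W_bounded_below by blast
  have "x = 0" if "W x = 0" for x using K[of x] that by simp
  then show ?thesis using linear_injective_0[OF clinear_imp_linear[OF clinear_W]] by blast
qed

text \<open>Preimages \<open>T f\<close> of \<open>jordan_prod b f\<close> converge, because
  \<open>W\<close> is bounded below and \<open>jordan_prod b f\<close> tends to \<open>2 b\<close>.
  Half of their limit is a preimage of \<open>b\<close>.\<close>

lemma surj_W: "surj W"
proof -
  have "\<exists>t. W t = b" for b
  proof -
    obtain K where K: "0 \<le> K" "\<And>x. norm x \<le> K * norm (W x)" using W_bounded_below by blast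
    obtain T where T: "\<And>f. W (T f) = jordan_prod b f"
      using W_preimage_jordan_prod by metis
    have "dist (T f) (T g) \<le> K * dist (jordan_prod b f) (jordan_prod b g)" for f g
      using K(2)[of "T f - T g"] by (simp add: dist_norm linear_diff[OF clinear_imp_linear[OF clinear_W]] T)
    then obtain t where t: "(T \<longlongrightarrow> t) G"
      using filter_limit_exists_dominated[OF B.nontrivial B.tendsto_jordan_prod K(1)] by blast
    \<comment> \<open>The limit passes through \<open>W\<close> after multiplication by
      \<open>z\<close>, since \<open>W (T f) * z = T f * W z\<close>.\<close>
    have "W ((1/2) *\<^sub>R t) - b = 0"
    proof (rule B.eq_zero_if_mult_zero)
      fix z
      have "((\<lambda>f. W (T f) * z) \<longlongrightarrow> (2 *\<^sub>R b) * z) G"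
        unfolding T by (intro tendsto_mult_right B.tendsto_jordan_prod)
      moreover have "((\<lambda>f. W (T f) * z) \<longlongrightarrow> t * W z) G"
        unfolding W_commute by (intro tendsto_mult_right t)
      ultimately have "t * W z = (2 *\<^sub>R b) * z" using tendsto_unique[OF B.nontrivial] by blast
      then have "W ((1/2) *\<^sub>R t) * z = b * z" by (simp add: W_commute)
      then show "(W ((1/2) *\<^sub>R t) - b) * z = 0" by (simp add: left_diff_distrib)
    qed
    then show ?thesis by auto
  qed
  then show ?thesis by (metis surjI)
qed

lemma weighted: "weighted_jordan_homomorphism \<Phi>"
  unfolding weighted_jordan_homomorphism_def
proof (intro exI conjI)
  define \<Psi> where "\<Psi> = inv W \<circ> \<Phi>"
  have W\<Psi>: "W (\<Psi> a) = \<Phi> a" for a by (simp add: \<Psi>_def surj_f_inv_f[OF surj_W])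
  show "centralizer W" by (rule centralizer_W)
  show "bij W" using inj_W surj_W by (simp add: bij_def)
  show "\<Phi> = W \<circ> \<Psi>" using W\<Psi> by auto
  have "\<Psi> (x + y) = \<Psi> x + \<Psi> y" for x y
    by (rule injD[OF inj_W]) (simp only: W\<Psi> clinear_add[OF clinear_W] clinear_add[OF \<Phi>_clinear])
  moreover have "\<Psi> (c *\<^sub>C x) = c *\<^sub>C \<Psi> x" for c x
    by (rule injD[OF inj_W]) (simp only: W\<Psi> clinear_scaleC[OF clinear_W] clinear_scaleC[OF \<Phi>_clinear])
  ultimately have "clinear \<Psi>" by (simp add: clinear_iff)
  moreover have "\<Psi> (jordan_prod a b) = jordan_prod (\<Psi> a) (\<Psi> b)" for a b
  proof -
    have WW: "W (W (x * y)) = W x * W y" for x y by (simp only: W_commute W_mult_right)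
    \<comment> \<open>Both sides of the Jordan identity are compared after applying \<open>W\<close>
      twice, where they become \<open>jordan_prod (\<Phi> a) (\<Phi> b)\<close>; injectivity of
      \<open>W\<close> is then used twice.\<close>
    have "W (W (jordan_prod (\<Psi> a) (\<Psi> b))) = jordan_prod (\<Phi> a) (\<Phi> b)"
      by (simp only: jordan_prod_def clinear_add[OF clinear_W] WW W\<Psi>)
    also have "\<dots> = W (W (\<Psi> (jordan_prod a b)))" by (simp only: W\<Psi> W_\<Phi> S_jordan_prod)
    finally show ?thesis using inj_W by (simp add: inj_eq)
  qed
  ultimately show "jordan_homomorphism \<Psi>" by (simp add: jordan_homomorphism_def)
qed

end

section \<open>From continuity to boundedness, and the conclusion\<close>

lemma clinear_continuous_imp_bounded_linear:
  fixes f :: "'a::complex_normed_vector \<Rightarrow> 'b::complex_normed_vector"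
  assumes "clinear f" "continuous_on UNIV f"
  shows "bounded_linear f"
proof -
  interpret linear f by (rule clinear_imp_linear) fact
  have "isCont f 0" using assms(2) continuous_on_eq_continuous_at open_UNIV by blast
  then have "(f \<longlongrightarrow> 0) (at 0)" by (simp add: isCont_def zero)
  from LIM_D[OF this zero_less_one] obtain d
    where d: "0 < d" "\<And>x. x \<noteq> 0 \<Longrightarrow> norm x < d \<Longrightarrow> norm (f x) < 1"
    by auto
  have "norm (f x) \<le> norm x * (2 / d)" for x
  proof (cases "x = 0")
    case False
    \<comment> \<open>The vector \<open>t x\<close> has norm \<open>d / 2\<close>, strictly inside
      the ball that \<open>f\<close> maps into the unit ball.\<close>
    define t where "t = d / (2 * norm x)"
    have "0 < t" using d(1) False by (simp add: t_def)
    have "norm (t *\<^sub>R x) < d" using d(1) False by (simp add: t_def)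
    then have "t * norm (f x) < 1" using d(2)[of "t *\<^sub>R x"] False \<open>0 < t\<close> by (simp add: scale)
    then show ?thesis using d(1) False by (simp add: t_def field_simps)
  qed (simp add: zero)
  then show ?thesis by (rule bounded_linear_intro[OF add scale])
qed

theorem theorem2p5:
  fixes \<Phi> :: "'a::complex_banach_algebra \<Rightarrow> 'b::complex_banach_algebra"
  assumes "zero_product_determined TYPE('a)"
    and "has_bounded_approximate_identity TYPE('a)"
    and "weakly_amenable TYPE('a)"
    and "has_bounded_approximate_identity TYPE('b)"
    and "clinear \<Phi>" and "continuous_on UNIV \<Phi>" and "surj \<Phi>"
    and "preserves_two_sided_zero_products \<Phi>"
  shows "weighted_jordan_homomorphism \<Phi>"
proof -
  obtain F :: "'a filter" and C where F: "approximate_identity F C" by (rule bai_obtains[OF assms(2)])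
  obtain G :: "'b filter" and C' where G: "approximate_identity G C'" by (rule bai_obtains[OF assms(4)])
  have \<Phi>: "bounded_linear \<Phi>" by (rule clinear_continuous_imp_bounded_linear) fact+
  have "zero_product_map F C \<Phi>"
  proof (intro zero_product_map.intro zero_product_map_axioms.intro F \<Phi> assms(5))
    fix \<xi> :: "'b \<Rightarrow> complex"
    assume \<xi>: "clinear \<xi>" "\<And>x. cmod (\<xi> x) \<le> norm x"
    \<comment> \<open>The representation of two-sided zero product functionals is applied to this
      form, separately for each \<open>\<xi>\<close>.\<close>
    have "bounded_bilinear (\<lambda>a b. \<xi> (\<Phi> a * \<Phi> b))"
      by (intro bounded_bilinear.comp[OF _ \<Phi> \<Phi>] bounded_bilinear_contraction_mult \<xi>)
    then have bil: "bounded_cbilinear (\<lambda>a b. \<xi> (\<Phi> a * \<Phi> b))"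
      by (intro bounded_cbilinear.intro bounded_cbilinear_axioms.intro clinear_compose[OF \<xi>(1)]
        clinear_compose[OF clinear_mult_left assms(5)] clinear_compose[OF clinear_mult_right assms(5)])
    have zero: "\<xi> (\<Phi> a * \<Phi> b) = 0" if "a * b = 0" "b * a = 0" for a b
      using assms(8) that linear_0[OF clinear_imp_linear[OF \<xi>(1)]]
      by (simp add: preserves_two_sided_zero_products_def)
    obtain \<sigma> \<tau> where "bounded_linear \<sigma>" "bounded_linear \<tau>"
      "\<And>a b. \<xi> (\<Phi> a * \<Phi> b) = \<sigma> (a * b) + \<tau> (b * a)"
      by (rule approximate_identity.two_sided_zero_product_functional[OF F assms(1,3) bil zero], assumption+, rule that)
    then show "\<exists>\<sigma> \<tau>. bounded_linear \<sigma> \<and> bounded_linear \<tau> \<and>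
        (\<forall>a b. \<xi> (\<Phi> a * \<Phi> b) = \<sigma> (a * b) + \<tau> (b * a))"
      by blast
  qed
  then have "zero_product_surjection F C \<Phi> G C'"
    by (intro zero_product_surjection.intro zero_product_surjection_axioms.intro G assms(7))
  then show ?thesis by (rule zero_product_surjection.weighted)
qed

end
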